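(* Consider an $n$-end-node star network with bit-flip channels with parameter vector $\theta=(\theta_0,\dots,\theta_{n-1})$. Suppose the root applies the circuit $\mathcal{C}_0=[H\otimes I,\ \mathrm{CNOT},\ XHX\otimes I]$ and the intermediate node applies the circuit $\mathcal{C}_n=[HZ\otimes I^{\otimes(n-2)},\ T_{n-1}]$ in the GHZ distribution process. These circuits transform the state $\theta_0\Phi_0^0+(1-\theta_0)\Phi_1^0$ (the state the intermediate node would receive if the root only prepared $\Phi_0^0$) into $\theta_0\Phi_0^0+(1-\theta_0)\Phi_0^1$ before the intermediate node transmits. The final state distributed across the end-nodes is then the $n$-qubit density matrix $$\rho(\theta)=\sum_{s\in\{0,1\}^{n-1}}\left[\theta_0\,\beta_0(s)\,\Phi_s^0+(1-\theta_0)\,\beta_1(s)\,\Phi_s^1\right],$$ $$\beta_0(s)=\prod_{j:\,s_j=0}\theta_j\prod_{j:\,s_j=1}(1-\theta_j),\qquad \beta_1(s)=\prod_{j:\,s_j=1}\theta_j\prod_{j:\,s_j=0}(1-\theta_j),$$ with products over $j\in\{1,\dots,n-1\}$. If $\rho(\theta)$ is measured in the GHZ basis, yielding $|\Phi_s^b\rangle$, then a bit-flip occurred in channel $0$ if and only if $b=1$, and a bit-flip occurred in channel $j>0$ if and only if $s_j=1$. Thus measuring the phase $b$ gives a direct estimator for $\theta_0$ for all its possible values. All parameters of the network are estimated by counting the number of times $b=1$ and $s_j=1$ in the outcomes of GHZ measurements. This estimator identifies the parameters without any additional assumptions.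
   Context: A star quantum network has $n$ end-nodes $0,\dots,n-1$ and one intermediate node, labelled $n$. End-node $j$ is joined to the intermediate node by the single-qubit bit-flip channel $\mathcal{E}_j(\rho)=\theta_j\rho+(1-\theta_j)X\rho X$, where $\theta_j$ is a probability; a bit-flip in channel $j$ is the event that $X$ is applied. Operations and measurements at nodes are noiseless, and registers are initialized in $|0\rangle$. End-nodes may perform global measurements, which can be attained with pre-shared entanglement. $X,Z$ are Pauli operators, $H$ is the Hadamard gate, and CNOT is controlled by the first qubit. A circuit $[A,B,\dots]$ applies the gates in the listed order. $T_m=|0\rangle\langle0|\otimes I^{\otimes(m-1)}+|1\rangle\langle1|\otimes X^{\otimes(m-1)}$ is the $m$-qubit generalized Toffoli gate. The GHZ states are $|\Phi_s^b\rangle=\frac{1}{\sqrt2}\left(|0s\rangle+(-1)^b|1\overline{s}\rangle\right)$ with $s$ a bit string, $b\in\{0,1\}$ and $\overline{s}$ the bitwise complement of $s$; $\Phi_s^b=|\Phi_s^b\rangle\langle\Phi_s^b|$. For $n$ qubits, $s=(s_1,\dots,s_{n-1})\in\{0,1\}^{n-1}$. For two qubits, $s$ is a single bit. The GHZ distribution process is as follows. Node $0$ (the root) applies $\mathcal{C}_0$ to two qubits, keeps the first, and sends the second to the intermediate node through $\mathcal{E}_0$. The intermediate node applies $\mathcal{C}_n$ to the received qubit (first position, the control of $T_{n-1}$) and $n-2$ register qubits in $|0\rangle$. It then sends one of its $n-1$ qubits to each end-node $j=1,\dots,n-1$ through $\mathcal{E}_j$. The resulting $n$-qubit state, including the qubit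 kept by the root, is $\rho(\theta)$.
   Formalization: The root's last gate is XH instead of XHX (as printed, Φ^0 and Φ^1 come out interchanged; that state is also proved), and the weight of Φ_s^1 is (1-θ_0)β_0(s) instead of (1-θ_0)β_1(s), equivalently β_1(s) goes with Φ^1 of the complement of s. *)

theory Defs
  imports
    "HOL-Probability.Probability"
    "Jordan_Normal_Form.Schur_Decomposition"
begin

section \<open>Qubits, gates and circuits\<close>

text \<open>A state of \<open>m\<close> qubits has dimension \<open>2 ^ m\<close>; the leftmost tensor factor is the most
  significant digit of an index.\<close>

definition tensor_vec :: "complex Matrix.vec \<Rightarrow> complex Matrix.vec \<Rightarrow> complex Matrix.vec"
    (infixr "\<otimes>\<^sub>v" 71) where
  "u \<otimes>\<^sub>v v = Matrix.vec (dim_vec u * dim_vec v)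
     (\<lambda>i. vec_index u (i div dim_vec v) * vec_index v (i mod dim_vec v))"

definition tensor_mat :: "complex Matrix.mat \<Rightarrow> complex Matrix.mat \<Rightarrow> complex Matrix.mat"
    (infixr "\<otimes>\<^sub>m" 71) where
  "A \<otimes>\<^sub>m B = Matrix.mat (dim_row A * dim_row B) (dim_col A * dim_col B)
     (\<lambda>(i, j). A $$ (i div dim_row B, j div dim_col B) * B $$ (i mod dim_row B, j mod dim_col B))"

fun tensor_power :: "complex Matrix.mat \<Rightarrow> nat \<Rightarrow> complex Matrix.mat" where
  "tensor_power A 0 = 1\<^sub>m 1"
| "tensor_power A (Suc k) = A \<otimes>\<^sub>m tensor_power A k"

fun ket :: "bool list \<Rightarrow> complex Matrix.vec" where
  "ket [] = unit_vec 1 0"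
| "ket (b # s) = unit_vec 2 (of_bool b) \<otimes>\<^sub>v ket s"

definition proj :: "complex Matrix.vec \<Rightarrow> complex Matrix.mat" where
  "proj v = Matrix.mat (dim_vec v) (dim_vec v) (\<lambda>(i, j). vec_index v i * cnj (vec_index v j))"

definition pauli_X :: "complex Matrix.mat" where
  "pauli_X = mat_of_rows_list 2 [[0, 1], [1, 0]]"

definition pauli_Z :: "complex Matrix.mat" where
  "pauli_Z = mat_of_rows_list 2 [[1, 0], [0, -1]]"

definition hadamard :: "complex Matrix.mat" where
  "hadamard = complex_of_real (1 / sqrt 2) \<cdot>\<^sub>m mat_of_rows_list 2 [[1, 1], [1, -1]]"

definition cnot :: "complex Matrix.mat" where
  "cnot = proj (ket [False]) \<otimes>\<^sub>m 1\<^sub>m 2 + proj (ket [True]) \<otimes>\<^sub>m pauli_X"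

definition toffoli :: "nat \<Rightarrow> complex Matrix.mat" where
  "toffoli m = proj (ket [False]) \<otimes>\<^sub>m 1\<^sub>m (2 ^ (m - 1))
     + proj (ket [True]) \<otimes>\<^sub>m tensor_power pauli_X (m - 1)"

text \<open>A circuit is the list of its gates in order of application.\<close>

definition run_circuit :: "complex Matrix.mat list \<Rightarrow> complex Matrix.mat \<Rightarrow> complex Matrix.mat" where
  "run_circuit gates \<rho> = fold (\<lambda>U \<sigma>. U * \<sigma> * mat_adjoint U) gates \<rho>"

definition density_operator :: "nat \<Rightarrow> complex Matrix.mat \<Rightarrow> bool" where
  "density_operator d \<rho> \<longleftrightarrow> \<rho> \<in> carrier_mat d d \<and> mat_adjoint \<rho> = \<rho> \<and>
     (\<forall>v \<in> carrier_vec d. Re ((\<rho> *\<^sub>v v) \<bullet>c v) \<ge> 0) \<and> (\<Sum>i<d. \<rho> $$ (i, i)) = 1"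

text \<open>Matrices of a fixed size are not a type, so \<open>sum\<close> does not apply to them.\<close>

definition mat_sum :: "nat \<Rightarrow> ('b \<Rightarrow> complex Matrix.mat) \<Rightarrow> 'b set \<Rightarrow> complex Matrix.mat" where
  "mat_sum d f S = Matrix.mat d d (\<lambda>(i, j). \<Sum>s\<in>S. f s $$ (i, j))"


section \<open>GHZ states and the GHZ measurement\<close>

definition ghz_vec :: "bool \<Rightarrow> bool list \<Rightarrow> complex Matrix.vec" where
  "ghz_vec b s = complex_of_real (1 / sqrt 2) \<cdot>\<^sub>v
     (ket (False # s) + ((-1) ^ of_bool b) \<cdot>\<^sub>v ket (True # map Not s))"

definition ghz :: "bool \<Rightarrow> bool list \<Rightarrow> complex Matrix.mat" where
  "ghz b s = proj (ghz_vec b s)"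

definition ghz_born :: "complex Matrix.mat \<Rightarrow> bool \<Rightarrow> bool list \<Rightarrow> real" where
  "ghz_born \<rho> b s = Re ((\<rho> *\<^sub>v ghz_vec b s) \<bullet>c ghz_vec b s)"

text \<open>The outcome \<open>(b, s)\<close> stands for the GHZ state \<open>ghz_vec b s\<close>.\<close>

definition ghz_measure :: "nat \<Rightarrow> complex Matrix.mat \<Rightarrow> (bool \<times> bool list) pmf" where
  "ghz_measure n \<rho> = embed_pmf (\<lambda>(b, s). if length s = n - 1 then ghz_born \<rho> b s else 0)"


section \<open>GHZ distribution in a star network\<close>

text \<open>\<open>X\<close> on the qubit at position \<open>k\<close> (counted from 0) of \<open>m\<close> qubits.\<close>

definition X_on :: "nat \<Rightarrow> nat \<Rightarrow> complex Matrix.mat" where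
  "X_on m k = 1\<^sub>m (2 ^ k) \<otimes>\<^sub>m pauli_X \<otimes>\<^sub>m 1\<^sub>m (2 ^ (m - k - 1))"

text \<open>In \<open>E j m k\<close>, channel \<open>j\<close> carries the qubit at position \<open>k\<close> of a state of \<open>m\<close> qubits.
  Besides the bit-flip channels themselves we need, for the statements about the event that a
  bit-flip occurs, the evolution under a fixed pattern \<open>e\<close> of bit-flips.\<close>

type_synonym links = "nat \<Rightarrow> nat \<Rightarrow> nat \<Rightarrow> complex Matrix.mat \<Rightarrow> complex Matrix.mat"

definition bit_flip_channels :: "(nat \<Rightarrow> real) \<Rightarrow> links" where
  "bit_flip_channels \<theta> j m k \<rho> =
     complex_of_real (\<theta> j) \<cdot>\<^sub>m \<rho> + complex_of_real (1 - \<theta> j) \<cdot>\<^sub>m (X_on m k * \<rho> * X_on m k)"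

definition flip_pattern :: "(nat \<Rightarrow> bool) \<Rightarrow> links" where
  "flip_pattern e j m k \<rho> = (if e j then X_on m k * \<rho> * X_on m k else \<rho>)"

definition received_state :: "complex Matrix.mat list \<Rightarrow> links \<Rightarrow> complex Matrix.mat" where
  "received_state C0 E = E 0 2 1 (run_circuit C0 (proj (ket [False, False])))"

text \<open>The intermediate node acts on all qubits but the one kept by the root.\<close>

definition intermediate_step ::
    "nat \<Rightarrow> complex Matrix.mat list \<Rightarrow> complex Matrix.mat \<Rightarrow> complex Matrix.mat" where
  "intermediate_step n Cn \<rho> = run_circuit (map (\<lambda>U. 1\<^sub>m 2 \<otimes>\<^sub>m U) Cn)
     (\<rho> \<otimes>\<^sub>m proj (ket (replicate (n - 2) False)))"

definition distributed_state ::
    "nat \<Rightarrow> complex Matrix.mat list \<Rightarrow> complex Matrix.mat list \<Rightarrow> links \<Rightarrow> complex Matrix.mat" where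
  "distributed_state n C0 Cn E =
     fold (\<lambda>j. E j n j) [1..<n] (intermediate_step n Cn (received_state C0 E))"

text \<open>With \<open>V = XHX\<close> in the root circuit, the two circuits give the announced states with the
  phases \<open>b = 0\<close> and \<open>b = 1\<close> interchanged: \<open>(XHX \<otimes> HZ)\<close> maps the two-qubit vector
  \<open>ghz_vec False [False]\<close> to \<open>- ghz_vec True [False]\<close> and \<open>ghz_vec False [True]\<close> to
  \<open>ghz_vec False [False]\<close>. With \<open>V = XH\<close> the images are \<open>ghz_vec False [False]\<close> and
  \<open>- ghz_vec True [False]\<close>, as intended: the superfluous \<open>X\<close> acts on
  \<open>ghz_vec False [False]\<close> exactly like a bit-flip in channel 0.\<close>

definition root_circuit :: "complex Matrix.mat \<Rightarrow> complex Matrix.mat list" where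
  "root_circuit V = [hadamard \<otimes>\<^sub>m 1\<^sub>m 2, cnot, V \<otimes>\<^sub>m 1\<^sub>m 2]"

definition intermediate_circuit :: "nat \<Rightarrow> complex Matrix.mat list" where
  "intermediate_circuit n = [(hadamard * pauli_Z) \<otimes>\<^sub>m 1\<^sub>m (2 ^ (n - 2)), toffoli (n - 1)]"

text \<open>The bit \<open>s\<^sub>j\<close> of \<open>s = (s\<^sub>1, \<dots>, s\<^sub>n\<^sub>-\<^sub>1)\<close> is \<open>s ! (j - 1)\<close>.\<close>

definition beta0 :: "nat \<Rightarrow> (nat \<Rightarrow> real) \<Rightarrow> bool list \<Rightarrow> real" where
  "beta0 n \<theta> s = (\<Prod>j\<in>{j \<in> {1..<n}. \<not> s ! (j - 1)}. \<theta> j) * (\<Prod>j\<in>{j \<in> {1..<n}. s ! (j - 1)}. 1 - \<theta> j)"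

definition beta1 :: "nat \<Rightarrow> (nat \<Rightarrow> real) \<Rightarrow> bool list \<Rightarrow> real" where
  "beta1 n \<theta> s = (\<Prod>j\<in>{j \<in> {1..<n}. s ! (j - 1)}. \<theta> j) * (\<Prod>j\<in>{j \<in> {1..<n}. \<not> s ! (j - 1)}. 1 - \<theta> j)"


text \<open>\<open>beta1 n \<theta> s = beta0 n \<theta> (map Not s)\<close>, so the weight \<open>beta1 n \<theta> s\<close> belongs to
  \<open>ghz True (map Not s)\<close>: a pattern \<open>e\<close> of bit-flips on the transmitted qubits turns
  \<open>ghz b (replicate (n - 1) False)\<close> into \<open>ghz b e\<close> for either phase \<open>b\<close>.\<close>


section \<open>Bit-flip events and estimation\<close>

definition flip_pmf :: "nat \<Rightarrow> (nat \<Rightarrow> real) \<Rightarrow> (nat \<Rightarrow> bool) pmf" where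
  "flip_pmf n \<theta> = Pi_pmf {..<n} False (\<lambda>j. bernoulli_pmf (1 - \<theta> j))"

text \<open>Joint law of the bit-flips in one run and of the outcome of the GHZ measurement.\<close>

definition flips_and_outcome ::
    "nat \<Rightarrow> complex Matrix.mat list \<Rightarrow> complex Matrix.mat list \<Rightarrow> (nat \<Rightarrow> real) \<Rightarrow>
     ((nat \<Rightarrow> bool) \<times> (bool \<times> bool list)) pmf" where
  "flips_and_outcome n C0 Cn \<theta> = bind_pmf (flip_pmf n \<theta>)
     (\<lambda>e. map_pmf (Pair e) (ghz_measure n (distributed_state n C0 Cn (flip_pattern e))))"

definition indicator_bit :: "nat \<Rightarrow> bool \<times> bool list \<Rightarrow> bool" where
  "indicator_bit j r = (if j = 0 then fst r else snd r ! (j - 1))"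

definition runs_pmf :: "nat \<Rightarrow> (bool \<times> bool list) pmf \<Rightarrow> (nat \<Rightarrow> bool \<times> bool list) pmf" where
  "runs_pmf N p = Pi_pmf {..<N} (False, []) (\<lambda>_. p)"

definition estimate :: "nat \<Rightarrow> nat \<Rightarrow> (nat \<Rightarrow> bool \<times> bool list) \<Rightarrow> real" where
  "estimate N j r = 1 - real (card {k. k < N \<and> indicator_bit j (r k)}) / real N"

definition flip_parameters :: "nat \<Rightarrow> (nat \<Rightarrow> real) \<Rightarrow> bool" where
  "flip_parameters n \<theta> \<longleftrightarrow> (\<forall>j<n. 0 \<le> \<theta> j \<and> \<theta> j \<le> 1)"

end

theory Submission
  imports Defs
begin

text \<open>
  Up to a sign, the two circuits send the Bell vectors without and with a bit-flip in channel 0 to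
  the two \<open>n\<close>-qubit GHZ vectors with all bits \<open>0\<close> and phase \<open>b = 0\<close> and \<open>b = 1\<close>. A bit-flip on
  qubit \<open>j\<close> complements the bit \<open>s\<^sub>j\<close> and, because complementing a position in both branches
  commutes with the relative sign, leaves \<open>b\<close> alone. A fixed pattern \<open>e\<close> of bit-flips thus yields the
  GHZ state with \<open>b = e 0\<close> and \<open>s = (e 1, \<dots>, e (n - 1))\<close>, so the outcome of the measurement is a copy
  of the independent bits \<open>e\<close>. Each bit being Bernoulli with parameter \<open>1 - \<theta> j\<close>, the counts are
  binomial, and consistency follows from Hoeffding's inequality.
\<close>


section \<open>Tensor products\<close>

text \<open>Why a flip turns into a phase: \<open>HZ = XH\<close>, so the two nodes together apply
  the same gate \<open>A = XH\<close> to both qubits of the Bell pair. As \<open>A\<close> is real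
  orthogonal, \<open>A\<close> on both qubits fixes the Bell vector with bit 0 and phase 0. An
  \<open>X\<close> on the transmitted qubit is conjugated to \<open>A X A^-1 = X Z X = -Z\<close>,
  which is a phase flip up to the sign.

  The channels give a mixture, whereas a fixed pattern of flips gives a pure state, and the
  statements about flip events need both evolutions. They are computed separately and meet in one
  law, \<open>outcome_pmf\<close>. On the side of the channels, the state stays diagonal in the GHZ
  basis, so that orthonormality reads the probabilities off its weights.

  Two encodings shape the work. Linearity over \<open>mat_sum\<close> must carry dimensions and is
  proved entry by entry. \<open>ghz_measure\<close> is an \<open>embed_pmf\<close>, meaningful only
  for normalized weights; it is identified by exhibiting a distribution that already has the Born
  weights.\<close>

lemma dim_tensor_vec [simp]: "dim_vec (u \<otimes>\<^sub>v v) = dim_vec u * dim_vec v"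
  by (simp add: tensor_vec_def)

lemma tensor_vec_carrier [simp, intro]:
  "u \<in> carrier_vec a \<Longrightarrow> v \<in> carrier_vec b \<Longrightarrow> u \<otimes>\<^sub>v v \<in> carrier_vec (a * b)"
  unfolding carrier_vec_def by simp

lemma index_tensor_vec [simp]:
  "i < dim_vec u * dim_vec v \<Longrightarrow>
    vec_index (u \<otimes>\<^sub>v v) i = vec_index u (i div dim_vec v) * vec_index v (i mod dim_vec v)"
  by (simp add: tensor_vec_def)

lemma dim_tensor_mat [simp]:
  "dim_row (A \<otimes>\<^sub>m B) = dim_row A * dim_row B"
  "dim_col (A \<otimes>\<^sub>m B) = dim_col A * dim_col B"
  by (simp_all add: tensor_mat_def)

lemma tensor_mat_carrier [simp, intro]:
  "A \<in> carrier_mat a c \<Longrightarrow> B \<in> carrier_mat b d \<Longrightarrow> A \<otimes>\<^sub>m B \<in> carrier_mat (a * b) (c * d)"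
  unfolding carrier_mat_def by simp

lemma index_tensor_mat [simp]:
  "i < dim_row A * dim_row B \<Longrightarrow> j < dim_col A * dim_col B \<Longrightarrow>
    (A \<otimes>\<^sub>m B) $$ (i, j) =
      A $$ (i div dim_row B, j div dim_col B) * B $$ (i mod dim_row B, j mod dim_col B)"
  by (simp add: tensor_mat_def)

lemma div_less_of_less_mult: "i < a * b \<Longrightarrow> i div b < a" for i a b :: nat
  by (simp add: less_mult_imp_div_less)

lemma mod_less_of_less_mult: "i < a * b \<Longrightarrow> i mod b < b" for i a b :: nat
  by (cases "b = 0") auto

lemmas div_mod_less = div_less_of_less_mult mod_less_of_less_mult

text \<open>An index of a tensor product is a two-digit number in mixed radix. Reading off both
  digits is a bijection; it makes sums over the long index factor in the product rules
  below.\<close>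

lemma sum_div_mod:
  "(\<Sum>j = 0..<c * d. f (j div d) (j mod d)) = (\<Sum>k = 0..<c. \<Sum>l = 0..<d. f k l)"
  for f :: "nat \<Rightarrow> nat \<Rightarrow> 'a :: comm_monoid_add"
proof -
  have "(\<Sum>k = 0..<c. \<Sum>l = 0..<d. f k l) = (\<Sum>(k, l) \<in> {0..<c} \<times> {0..<d}. f k l)"
    by (simp add: sum.cartesian_product)
  also have "\<dots> = (\<Sum>j = 0..<c * d. f (j div d) (j mod d))"
  proof (rule sum.reindex_bij_witness[where i = "\<lambda>j. (j div d, j mod d)" and j = "\<lambda>(k, l). k * d + l"])
    fix a assume "a \<in> {0..<c} \<times> {0..<d}"
    then obtain k l where a: "a = (k, l)" "k < c" "l < d" by auto
    have "k * d + l < Suc k * d" using a by simp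
    also have "\<dots> \<le> c * d" using a by (intro mult_right_mono) auto
    finally show "(case a of (k, l) \<Rightarrow> k * d + l) \<in> {0..<c * d}" using a by simp
    show "((case a of (k, l) \<Rightarrow> k * d + l) div d, (case a of (k, l) \<Rightarrow> k * d + l) mod d) = a"
      "f ((case a of (k, l) \<Rightarrow> k * d + l) div d) ((case a of (k, l) \<Rightarrow> k * d + l) mod d)
        = (case a of (k, l) \<Rightarrow> f k l)"
      using a by simp_all
  next
    fix j assume "j \<in> {0..<c * d}"
    thus "(j div d, j mod d) \<in> {0..<c} \<times> {0..<d}"
      using div_less_of_less_mult[of j c d] mod_less_of_less_mult[of j c d] by simp
  qed simp
  finally show ?thesis by simp
qed

lemma mult_tensor_mat_vec:
  assumes "A \<in> carrier_mat a c" "B \<in> carrier_mat b d" "u \<in> carrier_vec c" "v \<in> carrier_vec d"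
  shows "(A \<otimes>\<^sub>m B) *\<^sub>v (u \<otimes>\<^sub>v v) = (A *\<^sub>v u) \<otimes>\<^sub>v (B *\<^sub>v v)"
proof (rule eq_vecI)
  fix i assume "i < dim_vec ((A *\<^sub>v u) \<otimes>\<^sub>v (B *\<^sub>v v))"
  hence i: "i < a * b" using assms by simp
  note i' = div_mod_less[OF i]
  have "vec_index ((A \<otimes>\<^sub>m B) *\<^sub>v (u \<otimes>\<^sub>v v)) i =
      (\<Sum>j = 0..<c * d. (A $$ (i div b, j div d) * vec_index u (j div d)) *
         (B $$ (i mod b, j mod d) * vec_index v (j mod d)))"
    using assms i by (auto simp: scalar_prod_def intro!: sum.cong)
  also have "\<dots> = (\<Sum>k = 0..<c. A $$ (i div b, k) * vec_index u k) *
      (\<Sum>l = 0..<d. B $$ (i mod b, l) * vec_index v l)"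
    by (subst sum_div_mod) (simp add: sum_product)
  also have "\<dots> = vec_index ((A *\<^sub>v u) \<otimes>\<^sub>v (B *\<^sub>v v)) i"
    using assms i i' by (auto simp: scalar_prod_def)
  finally show "vec_index ((A \<otimes>\<^sub>m B) *\<^sub>v (u \<otimes>\<^sub>v v)) i = vec_index ((A *\<^sub>v u) \<otimes>\<^sub>v (B *\<^sub>v v)) i" .
qed (use assms in simp)

lemma cscalar_prod_tensor_vec:
  assumes "u \<in> carrier_vec a" "u' \<in> carrier_vec a" "v \<in> carrier_vec b" "v' \<in> carrier_vec b"
  shows "(u \<otimes>\<^sub>v v) \<bullet>c (u' \<otimes>\<^sub>v v') = (u \<bullet>c u') * (v \<bullet>c v')"
proof -
  have "(u \<otimes>\<^sub>v v) \<bullet>c (u' \<otimes>\<^sub>v v') =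
      (\<Sum>j = 0..<a * b. (vec_index u (j div b) * cnj (vec_index u' (j div b))) *
         (vec_index v (j mod b) * cnj (vec_index v' (j mod b))))"
    using assms by (auto simp: scalar_prod_def div_mod_less intro!: sum.cong)
  also have "\<dots> = (u \<bullet>c u') * (v \<bullet>c v')"
    using assms by (subst sum_div_mod) (simp add: sum_product scalar_prod_def)
  finally show ?thesis .
qed

text \<open>An index of a threefold tensor product has three digits. Both ways of bracketing read
  the same high, middle and low digit, which is associativity.\<close>

lemma div_mod_mult_nat:
  "i div (b * c) = i div c div b" "i mod (b * c) div c = i div c mod b" "i mod (b * c) mod c = i mod c"
  for i b c :: nat
  by (metis div_mult2_eq mult.commute, cases "c = 0", simp_all add: mult.commute[of b] mod_mult2_eq)

lemma tensor_vec_assoc: "(u \<otimes>\<^sub>v v) \<otimes>\<^sub>v w = u \<otimes>\<^sub>v v \<otimes>\<^sub>v w"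
proof (rule eq_vecI)
  fix i assume "i < dim_vec (u \<otimes>\<^sub>v v \<otimes>\<^sub>v w)"
  hence i: "i < dim_vec u * dim_vec v * dim_vec w" by (simp add: mult.assoc)
  have "i mod (dim_vec v * dim_vec w) < dim_vec v * dim_vec w"
    using i by (intro mod_less_of_less_mult[of _ "dim_vec u"]) (simp add: mult.assoc)
  thus "vec_index ((u \<otimes>\<^sub>v v) \<otimes>\<^sub>v w) i = vec_index (u \<otimes>\<^sub>v v \<otimes>\<^sub>v w) i"
    using i div_less_of_less_mult[OF i] by (simp add: div_mod_mult_nat mult.assoc)
qed simp

lemma tensor_mat_assoc: "(A \<otimes>\<^sub>m B) \<otimes>\<^sub>m C = A \<otimes>\<^sub>m B \<otimes>\<^sub>m C"
proof (rule eq_matI)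
  fix i j assume "i < dim_row (A \<otimes>\<^sub>m B \<otimes>\<^sub>m C)" "j < dim_col (A \<otimes>\<^sub>m B \<otimes>\<^sub>m C)"
  hence i: "i < dim_row A * dim_row B * dim_row C" and j: "j < dim_col A * dim_col B * dim_col C"
    by (simp_all add: mult.assoc)
  have "i mod (dim_row B * dim_row C) < dim_row B * dim_row C"
    using i by (intro mod_less_of_less_mult[of _ "dim_row A"]) (simp add: mult.assoc)
  moreover have "j mod (dim_col B * dim_col C) < dim_col B * dim_col C"
    using j by (intro mod_less_of_less_mult[of _ "dim_col A"]) (simp add: mult.assoc)
  ultimately show "((A \<otimes>\<^sub>m B) \<otimes>\<^sub>m C) $$ (i, j) = (A \<otimes>\<^sub>m B \<otimes>\<^sub>m C) $$ (i, j)"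
    using i j div_less_of_less_mult[OF i] div_less_of_less_mult[OF j]
    by (simp add: div_mod_mult_nat mult.assoc)
qed simp_all

lemma tensor_vec_1_left [simp]: "unit_vec (Suc 0) 0 \<otimes>\<^sub>v v = v"
  by (rule eq_vecI) auto

lemma tensor_vec_1_right [simp]: "v \<otimes>\<^sub>v unit_vec (Suc 0) 0 = v"
  by (rule eq_vecI) auto

lemma tensor_vec_add_left:
  "dim_vec u = dim_vec v \<Longrightarrow> (u + v) \<otimes>\<^sub>v w = u \<otimes>\<^sub>v w + v \<otimes>\<^sub>v w"
  by (rule eq_vecI) (auto simp: div_mod_less algebra_simps)

lemma tensor_vec_smult_left: "(c \<cdot>\<^sub>v u) \<otimes>\<^sub>v w = c \<cdot>\<^sub>v (u \<otimes>\<^sub>v w)"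
  by (rule eq_vecI) (auto simp: div_mod_less)

section \<open>Conjugate transposes\<close>

lemma index_mat_adjoint [simp]:
  fixes A :: "complex Matrix.mat"
  shows "i < dim_col A \<Longrightarrow> j < dim_row A \<Longrightarrow> mat_adjoint A $$ (i, j) = cnj (A $$ (j, i))"
  by (simp add: mat_adjoint_def mat_of_rows_def)

lemma dim_mat_adjoint [simp]:
  fixes A :: "complex Matrix.mat"
  shows "dim_row (mat_adjoint A) = dim_col A" "dim_col (mat_adjoint A) = dim_row A"
  by (simp_all add: mat_adjoint_def)

lemma mat_adjoint_carrier [simp, intro]:
  fixes A :: "complex Matrix.mat"
  shows "A \<in> carrier_mat a b \<Longrightarrow> mat_adjoint A \<in> carrier_mat b a"
  unfolding carrier_mat_def by simp

lemma mat_adjoint_tensor: "mat_adjoint (A \<otimes>\<^sub>m B) = mat_adjoint A \<otimes>\<^sub>m mat_adjoint B"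
  by (rule eq_matI) (auto simp: div_mod_less)

lemma mat_adjoint_one: "mat_adjoint (1\<^sub>m a :: complex Matrix.mat) = 1\<^sub>m a"
  by (rule eq_matI) auto


section \<open>Projections and mixtures\<close>

lemma dim_proj [simp]: "dim_row (proj v) = dim_vec v" "dim_col (proj v) = dim_vec v"
  by (simp_all add: proj_def)

lemma proj_carrier [simp, intro]: "v \<in> carrier_vec d \<Longrightarrow> proj v \<in> carrier_mat d d"
  unfolding carrier_vec_def carrier_mat_def by simp

lemma index_proj [simp]:
  "i < dim_vec v \<Longrightarrow> j < dim_vec v \<Longrightarrow> proj v $$ (i, j) = vec_index v i * cnj (vec_index v j)"
  by (simp add: proj_def)

lemma proj_tensor: "proj u \<otimes>\<^sub>m proj v = proj (u \<otimes>\<^sub>v v)"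
  by (rule eq_matI) (auto simp: div_mod_less)

text \<open>\<open>U v v* U* = (U v)(U v)*\<close>. Noiseless evolution of a pure state can thus be
  followed on vectors.\<close>

lemma mult_proj_adjoint:
  assumes U: "U \<in> carrier_mat a d" and v: "v \<in> carrier_vec d"
  shows "U * proj v * mat_adjoint U = proj (U *\<^sub>v v)"
proof (rule eq_matI)
  fix i j assume "i < dim_row (proj (U *\<^sub>v v))" "j < dim_col (proj (U *\<^sub>v v))"
  hence ij: "i < a" "j < a" using U by auto
  have "(U * proj v * mat_adjoint U) $$ (i, j) =
      (\<Sum>k = 0..<d. (\<Sum>l = 0..<d. U $$ (i, l) * (vec_index v l * cnj (vec_index v k))) * cnj (U $$ (j, k)))"
    using U v ij by (auto simp: scalar_prod_def times_mat_def intro!: sum.cong)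
  also have "\<dots> = (\<Sum>l = 0..<d. U $$ (i, l) * vec_index v l) * cnj (\<Sum>k = 0..<d. U $$ (j, k) * vec_index v k)"
    by (simp add: sum_product sum_distrib_right mult_ac sum_distrib_left)
  also have "\<dots> = proj (U *\<^sub>v v) $$ (i, j)"
    using U v ij by (auto simp: scalar_prod_def)
  finally show "(U * proj v * mat_adjoint U) $$ (i, j) = proj (U *\<^sub>v v) $$ (i, j)" .
qed (use assms in simp_all)

text \<open>The right factor \<open>V\<close> is kept free: it is \<open>mat_adjoint U\<close> for a
  gate and \<open>X_on m k\<close> itself for a bit-flip.\<close>

lemma sandwich_mixture:
  fixes U V :: "complex Matrix.mat"
  assumes "U \<in> carrier_mat d d" "V \<in> carrier_mat d d" "A \<in> carrier_mat d d" "B \<in> carrier_mat d d"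
  shows "U * (a \<cdot>\<^sub>m A + b \<cdot>\<^sub>m B) * V = a \<cdot>\<^sub>m (U * A * V) + b \<cdot>\<^sub>m (U * B * V)"
proof -
  have "U * (a \<cdot>\<^sub>m A + b \<cdot>\<^sub>m B) = a \<cdot>\<^sub>m (U * A) + b \<cdot>\<^sub>m (U * B)"
    using assms by (simp add: mult_add_distrib_mat[of U d d _ d] mult_smult_distrib[of U d d _ d])
  moreover have "(a \<cdot>\<^sub>m (U * A) + b \<cdot>\<^sub>m (U * B)) * V = a \<cdot>\<^sub>m (U * A * V) + b \<cdot>\<^sub>m (U * B * V)"
    using assms by (subst add_mult_distrib_mat[where nr = d and n = d and nc = d])
      (auto simp: mult_smult_assoc_mat[where nr = d and n = d and nc = d])
  ultimately show ?thesis by simp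
qed

lemma run_circuit_proj:
  assumes "set gs \<subseteq> carrier_mat d d" "v \<in> carrier_vec d"
  shows "run_circuit gs (proj v) = proj (fold (*\<^sub>v) gs v)"
  using assms
proof (induction gs arbitrary: v)
  case (Cons U gs)
  have U: "U \<in> carrier_mat d d" using Cons.prems by simp
  have "run_circuit (U # gs) (proj v) = run_circuit gs (proj (U *\<^sub>v v))"
    using mult_proj_adjoint[OF U Cons.prems(2)] by (simp add: run_circuit_def)
  thus ?case using Cons U by simp
qed (simp add: run_circuit_def)

lemma run_circuit_mixture:
  assumes "set gs \<subseteq> carrier_mat d d" "A \<in> carrier_mat d d" "B \<in> carrier_mat d d"
  shows "run_circuit gs (a \<cdot>\<^sub>m A + b \<cdot>\<^sub>m B) = a \<cdot>\<^sub>m run_circuit gs A + b \<cdot>\<^sub>m run_circuit gs B"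
  using assms
proof (induction gs arbitrary: A B)
  case (Cons U gs)
  have U: "U \<in> carrier_mat d d" using Cons.prems by simp
  have "run_circuit (U # gs) (a \<cdot>\<^sub>m A + b \<cdot>\<^sub>m B) =
      run_circuit gs (a \<cdot>\<^sub>m (U * A * mat_adjoint U) + b \<cdot>\<^sub>m (U * B * mat_adjoint U))"
    using sandwich_mixture[of U d "mat_adjoint U"] U Cons.prems by (simp add: run_circuit_def)
  also have "\<dots> = a \<cdot>\<^sub>m run_circuit gs (U * A * mat_adjoint U) + b \<cdot>\<^sub>m run_circuit gs (U * B * mat_adjoint U)"
    using U Cons.prems by (intro Cons.IH) (auto intro!: mult_carrier_mat[where n = d])
  finally show ?case by (simp add: run_circuit_def)
qed (simp add: run_circuit_def)

section \<open>Finite sums of matrices\<close>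

lemma index_mat_sum [simp]:
  "i < d \<Longrightarrow> j < d \<Longrightarrow> mat_sum d f S $$ (i, j) = (\<Sum>s\<in>S. f s $$ (i, j))"
  by (simp add: mat_sum_def)

lemma dim_mat_sum [simp]: "dim_row (mat_sum d f S) = d" "dim_col (mat_sum d f S) = d"
  by (simp_all add: mat_sum_def)

lemma mat_sum_carrier [simp, intro]: "mat_sum d f S \<in> carrier_mat d d"
  unfolding carrier_mat_def by simp

lemma mat_sum_cong:
  "(\<And>s. s \<in> S \<Longrightarrow> f s = g s) \<Longrightarrow> mat_sum d f S = mat_sum d g S"
  by (rule eq_matI) auto

lemma mat_sum_mixture:
  assumes "\<And>s. s \<in> S \<Longrightarrow> f s \<in> carrier_mat d d" "\<And>s. s \<in> S \<Longrightarrow> g s \<in> carrier_mat d d"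
  shows "a \<cdot>\<^sub>m mat_sum d f S + b \<cdot>\<^sub>m mat_sum d g S = mat_sum d (\<lambda>s. a \<cdot>\<^sub>m f s + b \<cdot>\<^sub>m g s) S"
proof (rule eq_matI)
  fix i j assume "i < dim_row (mat_sum d (\<lambda>s. a \<cdot>\<^sub>m f s + b \<cdot>\<^sub>m g s) S)"
    "j < dim_col (mat_sum d (\<lambda>s. a \<cdot>\<^sub>m f s + b \<cdot>\<^sub>m g s) S)"
  hence ij: "i < d" "j < d" by auto
  have "(a \<cdot>\<^sub>m f s + b \<cdot>\<^sub>m g s) $$ (i, j) = a * f s $$ (i, j) + b * g s $$ (i, j)" if "s \<in> S" for s
    using assms that ij by (metis carrier_matD index_add_mat(1) index_smult_mat)
  thus "(a \<cdot>\<^sub>m mat_sum d f S + b \<cdot>\<^sub>m mat_sum d g S) $$ (i, j) =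
      mat_sum d (\<lambda>s. a \<cdot>\<^sub>m f s + b \<cdot>\<^sub>m g s) S $$ (i, j)"
    using ij by (simp add: sum_distrib_left sum.distrib)
qed auto

lemma sandwich_mat_sum:
  assumes U: "U \<in> carrier_mat d d" and V: "V \<in> carrier_mat d d"
    and f: "\<And>s. s \<in> S \<Longrightarrow> f s \<in> carrier_mat d d"
  shows "U * mat_sum d f S * V = mat_sum d (\<lambda>s. U * f s * V) S"
proof (rule eq_matI)
  fix i j assume "i < dim_row (mat_sum d (\<lambda>s. U * f s * V) S)" "j < dim_col (mat_sum d (\<lambda>s. U * f s * V) S)"
  hence ij: "i < d" "j < d" by auto
  \<comment> \<open>Stated for every \<open>M\<close>, so that it expands the sum and each of its
    summands; the two sides then differ only in the order of three summations.\<close>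
  have *: "(U * M * V) $$ (i, j) = (\<Sum>k = 0..<d. \<Sum>l = 0..<d. U $$ (i, l) * M $$ (l, k) * V $$ (k, j))"
    if "M \<in> carrier_mat d d" for M
    using U V that ij by (auto simp: scalar_prod_def times_mat_def sum_distrib_right intro!: sum.cong)
  have "(U * mat_sum d f S * V) $$ (i, j) =
      (\<Sum>k = 0..<d. \<Sum>l = 0..<d. \<Sum>s\<in>S. U $$ (i, l) * f s $$ (l, k) * V $$ (k, j))"
    by (simp add: * sum_distrib_left sum_distrib_right)
  also have "\<dots> = (\<Sum>k = 0..<d. \<Sum>s\<in>S. \<Sum>l = 0..<d. U $$ (i, l) * f s $$ (l, k) * V $$ (k, j))"
    by (intro sum.cong refl sum.swap)
  also have "\<dots> = (\<Sum>s\<in>S. \<Sum>k = 0..<d. \<Sum>l = 0..<d. U $$ (i, l) * f s $$ (l, k) * V $$ (k, j))"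
    by (rule sum.swap)
  also have "\<dots> = mat_sum d (\<lambda>s. U * f s * V) S $$ (i, j)"
    using ij f by (simp add: *)
  finally show "(U * mat_sum d f S * V) $$ (i, j) = mat_sum d (\<lambda>s. U * f s * V) S $$ (i, j)" .
qed (use assms in auto)

section \<open>Quadratic forms, the source of positivity and of Born probabilities\<close>

lemma quadratic_form_mat_sum:
  assumes "v \<in> carrier_vec d" and f: "\<And>s. s \<in> S \<Longrightarrow> f s \<in> carrier_mat d d"
  shows "(mat_sum d f S *\<^sub>v v) \<bullet>c v = (\<Sum>s\<in>S. (f s *\<^sub>v v) \<bullet>c v)"
proof -
  have *: "(M *\<^sub>v v) \<bullet>c v = (\<Sum>i = 0..<d. \<Sum>j = 0..<d. M $$ (i, j) * vec_index v j * cnj (vec_index v i))"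
    if "M \<in> carrier_mat d d" for M
    using assms(1) that by (auto simp: scalar_prod_def sum_distrib_right intro!: sum.cong)
  have "(mat_sum d f S *\<^sub>v v) \<bullet>c v =
      (\<Sum>i = 0..<d. \<Sum>j = 0..<d. \<Sum>s\<in>S. f s $$ (i, j) * vec_index v j * cnj (vec_index v i))"
    by (simp add: * sum_distrib_right)
  also have "\<dots> = (\<Sum>i = 0..<d. \<Sum>s\<in>S. \<Sum>j = 0..<d. f s $$ (i, j) * vec_index v j * cnj (vec_index v i))"
    by (intro sum.cong refl sum.swap)
  also have "\<dots> = (\<Sum>s\<in>S. \<Sum>i = 0..<d. \<Sum>j = 0..<d. f s $$ (i, j) * vec_index v j * cnj (vec_index v i))"
    by (rule sum.swap)
  also have "\<dots> = (\<Sum>s\<in>S. (f s *\<^sub>v v) \<bullet>c v)"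
    using f by (simp add: *)
  finally show ?thesis .
qed

lemma quadratic_form_mixture:
  fixes A B :: "complex Matrix.mat"
  assumes "v \<in> carrier_vec d" "A \<in> carrier_mat d d" "B \<in> carrier_mat d d"
  shows "((a \<cdot>\<^sub>m A + b \<cdot>\<^sub>m B) *\<^sub>v v) \<bullet>c v = a * ((A *\<^sub>v v) \<bullet>c v) + b * ((B *\<^sub>v v) \<bullet>c v)"
  using assms by (simp add: scalar_prod_def sum_distrib_right sum_distrib_left distrib_left
      distrib_right sum.distrib mult.assoc)

text \<open>The double sum factors into \<open>u \<bullet>c v\<close> and its conjugate: the Born
  rule for a pure state.\<close>

lemma quadratic_form_proj:
  assumes "u \<in> carrier_vec d" "v \<in> carrier_vec d"
  shows "(proj u *\<^sub>v v) \<bullet>c v = complex_of_real ((cmod (u \<bullet>c v))\<^sup>2)"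
proof -
  have "(proj u *\<^sub>v v) \<bullet>c v =
      (\<Sum>i = 0..<d. (\<Sum>j = 0..<d. vec_index u i * cnj (vec_index u j) * vec_index v j) * cnj (vec_index v i))"
    using assms by (auto simp: scalar_prod_def intro!: sum.cong)
  also have "\<dots> = (u \<bullet>c v) * cnj (u \<bullet>c v)"
    using assms by (simp add: scalar_prod_def sum_product sum_distrib_left sum_distrib_right mult_ac)
      (rule sum.swap)
  finally show ?thesis by (simp only: complex_norm_square)
qed


section \<open>Computational basis states and gates\<close>

lemma ket_carrier [simp, intro]: "ket s \<in> carrier_vec (2 ^ length s)"
  by (induction s) auto

lemma dim_ket [simp]: "dim_vec (ket s) = 2 ^ length s"
  using ket_carrier by (rule carrier_vecD)

lemma ket_append: "ket (s @ t) = ket s \<otimes>\<^sub>v ket t"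
  by (induction s) (auto simp: tensor_vec_assoc)

lemma ket_single: "ket [b] = unit_vec 2 (of_bool b)"
  by simp

lemma ket_Cons: "ket (b # s) = ket [b] \<otimes>\<^sub>v ket s"
  by simp

text \<open>From here on kets of whole bit strings stay folded, so that rules about such strings
  match; \<open>ket_Cons\<close> splits off a factor on demand.\<close>

declare ket.simps(2) [simp del]

lemma ket_single_carrier [simp, intro]: "ket [b] \<in> carrier_vec 2"
  by (simp add: ket_single)

lemma proj_ket_single_carrier [simp, intro]: "proj (ket [b]) \<in> carrier_mat 2 2"
  by (rule proj_carrier) simp

lemma cscalar_prod_ket: "length s = length t \<Longrightarrow> ket s \<bullet>c ket t = of_bool (s = t)"
proof (induction s t rule: list_induct2)
  case (Cons b s c t)
  have "ket [b] \<bullet>c ket [c] = of_bool (b = c)"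
    by (cases b; cases c) (simp_all add: ket_single scalar_prod_def numeral_2_eq_2)
  moreover have "ket s \<in> carrier_vec (2 ^ length t)" using Cons by (metis ket_carrier)
  ultimately show ?case
    using Cons cscalar_prod_tensor_vec[of "ket [b]" 2 "ket [c]" "ket s" "2 ^ length t" "ket t"]
    by (simp add: ket_Cons[of b s] ket_Cons[of c t])
qed (simp add: scalar_prod_def)

lemma gate_carrier [simp, intro]:
  "pauli_X \<in> carrier_mat 2 2" "pauli_Z \<in> carrier_mat 2 2" "hadamard \<in> carrier_mat 2 2"
  by (simp_all add: pauli_X_def pauli_Z_def hadamard_def mat_of_rows_list_def numeral_2_eq_2)

lemma pauli_X_ket: "pauli_X *\<^sub>v ket [b] = ket [\<not> b]"
  by (rule eq_vecI, cases b)
    (auto simp: ket_single pauli_X_def mat_of_rows_list_def scalar_prod_def numeral_2_eq_2 less_Suc_eq)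

lemma mat_adjoint_pauli_X: "mat_adjoint pauli_X = pauli_X"
  by (rule eq_matI) (auto simp: pauli_X_def mat_of_rows_list_def numeral_2_eq_2 less_Suc_eq)

lemma proj_ket_single: "proj (ket [b]) *\<^sub>v ket [c] = of_bool (b = c) \<cdot>\<^sub>v ket [c]"
  by (rule eq_vecI, cases b; cases c)
    (auto simp: ket_single scalar_prod_def numeral_2_eq_2 less_Suc_eq)

text \<open>The two projections select one block according to the control bit. \<open>cnot\<close>
  and \<open>toffoli\<close> are both instances, with \<open>A\<close> the identity.\<close>

lemma controlled_ket:
  assumes "A \<in> carrier_mat d d" "B \<in> carrier_mat d d" "v \<in> carrier_vec d"
  shows "(proj (ket [False]) \<otimes>\<^sub>m A + proj (ket [True]) \<otimes>\<^sub>m B) *\<^sub>v (ket [c] \<otimes>\<^sub>v v) =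
    ket [c] \<otimes>\<^sub>v ((if c then B else A) *\<^sub>v v)"
proof -
  note P = proj_ket_single_carrier and K = ket_single_carrier
  have "(proj (ket [False]) \<otimes>\<^sub>m A + proj (ket [True]) \<otimes>\<^sub>m B) *\<^sub>v (ket [c] \<otimes>\<^sub>v v) =
      (proj (ket [False]) \<otimes>\<^sub>m A) *\<^sub>v (ket [c] \<otimes>\<^sub>v v) + (proj (ket [True]) \<otimes>\<^sub>m B) *\<^sub>v (ket [c] \<otimes>\<^sub>v v)"
    by (rule add_mult_distrib_mat_vec[of _ "2 * d" "2 * d"]) (use assms P K in \<open>auto\<close>)
  also have "\<dots> = (of_bool (False = c) \<cdot>\<^sub>v ket [c]) \<otimes>\<^sub>v (A *\<^sub>v v) + (of_bool (True = c) \<cdot>\<^sub>v ket [c]) \<otimes>\<^sub>v (B *\<^sub>v v)"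
    using mult_tensor_mat_vec[OF P assms(1) K assms(3)] mult_tensor_mat_vec[OF P assms(2) K assms(3)]
    by (simp add: proj_ket_single)
  also have "\<dots> = ket [c] \<otimes>\<^sub>v ((if c then B else A) *\<^sub>v v)"
    \<comment> \<open>One of the two summands carries the factor 0, the other the factor 1.\<close>
    using assms by (cases c; intro eq_vecI) (auto simp: tensor_vec_smult_left simp del: index_tensor_vec)
  finally show ?thesis .
qed

lemma tensor_power_carrier [simp, intro]:
  "A \<in> carrier_mat a b \<Longrightarrow> tensor_power A k \<in> carrier_mat (a ^ k) (b ^ k)"
  by (induction k) auto

lemma tensor_power_pauli_X_ket: "tensor_power pauli_X (length s) *\<^sub>v ket s = ket (map Not s)"
proof (induction s)
  case (Cons b s)
  have "(pauli_X \<otimes>\<^sub>m tensor_power pauli_X (length s)) *\<^sub>v (ket [b] \<otimes>\<^sub>v ket s) =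
      (pauli_X *\<^sub>v ket [b]) \<otimes>\<^sub>v (tensor_power pauli_X (length s) *\<^sub>v ket s)"
    by (rule mult_tensor_mat_vec[where c = 2 and d = "2 ^ length s"]) auto
  thus ?case using Cons by (simp add: pauli_X_ket flip: ket_Cons)
qed (simp add: one_mult_mat_vec)

lemma toffoli_carrier [simp, intro]: "m > 0 \<Longrightarrow> toffoli m \<in> carrier_mat (2 ^ m) (2 ^ m)"
proof (cases m)
  case (Suc k)
  thus "toffoli m \<in> carrier_mat (2 ^ m) (2 ^ m)"
    unfolding toffoli_def Suc by (simp)
qed simp

lemma toffoli_ket:
  "toffoli (Suc (length s)) *\<^sub>v ket (c # s) = ket (c # (if c then map Not s else s))"
proof -
  have "toffoli (Suc (length s)) *\<^sub>v (ket [c] \<otimes>\<^sub>v ket s) = ket [c] \<otimes>\<^sub>v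
      ((if c then tensor_power pauli_X (length s) else 1\<^sub>m (2 ^ length s)) *\<^sub>v ket s)"
    unfolding toffoli_def diff_Suc_1 by (rule controlled_ket[where d = "2 ^ length s"]) auto
  also have "\<dots> = ket [c] \<otimes>\<^sub>v ket (if c then map Not s else s)"
    by (auto simp: tensor_power_pauli_X_ket one_mult_mat_vec)
  finally show ?thesis by (simp only: flip: ket_Cons)
qed

lemma cnot_carrier [simp, intro]: "cnot \<in> carrier_mat 4 4"
proof -
  have "proj (ket [b]) \<otimes>\<^sub>m A \<in> carrier_mat (2 * 2) (2 * 2)" if "A \<in> carrier_mat 2 2" for A b
    using that proj_ket_single_carrier by blast
  from this[of pauli_X] show ?thesis
    unfolding cnot_def by simp
qed

lemma cnot_ket: "cnot *\<^sub>v ket [a, b] = ket [a, a \<noteq> b]"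
proof -
  have "cnot *\<^sub>v (ket [a] \<otimes>\<^sub>v ket [b]) = ket [a] \<otimes>\<^sub>v ((if a then pauli_X else 1\<^sub>m 2) *\<^sub>v ket [b])"
    unfolding cnot_def by (rule controlled_ket[where d = 2]) auto
  also have "\<dots> = ket [a] \<otimes>\<^sub>v ket [a \<noteq> b]"
    by (auto simp: pauli_X_ket one_mult_mat_vec)
  finally show ?thesis by (simp flip: ket_Cons)
qed

lemma X_on_carrier [simp, intro]: "k < m \<Longrightarrow> X_on m k \<in> carrier_mat (2 ^ m) (2 ^ m)"
proof -
  assume "k < m"
  hence "m = k + Suc (m - k - 1)" by simp
  hence "(2::nat) ^ m = 2 ^ k * (2 * 2 ^ (m - k - 1))"
    by (metis power_add power_Suc)
  thus ?thesis unfolding X_on_def by (simp only:) auto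
qed

lemma mat_adjoint_X_on: "mat_adjoint (X_on m k) = X_on m k"
  by (simp add: X_on_def mat_adjoint_tensor mat_adjoint_one mat_adjoint_pauli_X)

text \<open>The three tensor factors of \<open>X_on\<close> meet the prefix, the bit at position
  \<open>k\<close> and the suffix separately.\<close>

lemma X_on_ket:
  assumes k: "k < length s"
  shows "X_on (length s) k *\<^sub>v ket s = ket (s[k := \<not> s ! k])"
proof -
  let ?l = "take k s" and ?r = "drop (Suc k) s"
  have s: "ket s = ket ?l \<otimes>\<^sub>v ket [s ! k] \<otimes>\<^sub>v ket ?r"
    using id_take_nth_drop[OF k] by (metis ket_append append_Cons append_Nil)
  have "ket ?l \<in> carrier_vec (2 ^ k)" "ket ?r \<in> carrier_vec (2 ^ (length s - k - 1))"
    using k ket_carrier[of ?l] ket_carrier[of ?r] by simp_all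
  note l = this(1) and r = this(2)
  have "(pauli_X \<otimes>\<^sub>m 1\<^sub>m (2 ^ (length s - k - 1))) *\<^sub>v (ket [s ! k] \<otimes>\<^sub>v ket ?r) =
      (pauli_X *\<^sub>v ket [s ! k]) \<otimes>\<^sub>v ket ?r"
    using r by (subst mult_tensor_mat_vec[OF gate_carrier(1) one_carrier_mat ket_single_carrier r]) simp
  moreover have "X_on (length s) k *\<^sub>v ket s = (1\<^sub>m (2 ^ k) *\<^sub>v ket ?l) \<otimes>\<^sub>v
      ((pauli_X \<otimes>\<^sub>m 1\<^sub>m (2 ^ (length s - k - 1))) *\<^sub>v (ket [s ! k] \<otimes>\<^sub>v ket ?r))"
    unfolding s X_on_def
    by (rule mult_tensor_mat_vec[OF one_carrier_mat tensor_mat_carrier[OF gate_carrier(1) one_carrier_mat] l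
          tensor_vec_carrier[OF ket_single_carrier r]])
  ultimately have "X_on (length s) k *\<^sub>v ket s = ket ?l \<otimes>\<^sub>v (pauli_X *\<^sub>v ket [s ! k]) \<otimes>\<^sub>v ket ?r"
    using l by simp
  also have "\<dots> = ket (s[k := \<not> s ! k])"
    by (simp only: pauli_X_ket upd_conv_take_nth_drop[OF k] ket_append flip: ket_Cons)
  finally show ?thesis .
qed


section \<open>GHZ states\<close>

lemma ghz_vec_carrier [simp, intro]: "ghz_vec b s \<in> carrier_vec (2 ^ Suc (length s))"
  unfolding ghz_vec_def
  by (intro smult_carrier_vec[THEN iffD2] add_carrier_vec) (metis ket_carrier length_Cons length_map)+

lemma dim_ghz_vec [simp]: "dim_vec (ghz_vec b s) = 2 ^ Suc (length s)"
  using ghz_vec_carrier by (rule carrier_vecD)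

lemma ghz_carrier [simp, intro]: "ghz b s \<in> carrier_mat (2 ^ Suc (length s)) (2 ^ Suc (length s))"
  unfolding ghz_def by (rule proj_carrier) (rule ghz_vec_carrier)

text \<open>By linearity, the action of a gate on a GHZ vector follows from its action on two basis
  kets.\<close>

lemma mult_ghz_vec:
  assumes A: "A \<in> carrier_mat d (2 ^ Suc (length s))"
  shows "A *\<^sub>v ghz_vec b s = complex_of_real (1 / sqrt 2) \<cdot>\<^sub>v
     (A *\<^sub>v ket (False # s) + ((-1) ^ of_bool b) \<cdot>\<^sub>v (A *\<^sub>v ket (True # map Not s)))"
proof -
  have K: "ket (False # s) \<in> carrier_vec (2 ^ Suc (length s))"
    "ket (True # map Not s) \<in> carrier_vec (2 ^ Suc (length s))"
    by (metis ket_carrier length_Cons length_map)+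
  show ?thesis
    unfolding ghz_vec_def using A K
    by (simp add: mult_mat_vec[OF A] mult_add_distrib_mat_vec[OF A])
qed

text \<open>Flipping the same position in \<open>s\<close> and in its complement keeps them
  complementary and does not touch the relative sign. Position 0 is the qubit kept by the root,
  hence the index \<open>k - 1\<close> into \<open>s\<close>.\<close>

lemma X_on_ghz_vec:
  assumes k: "0 < k" "k \<le> length s"
  shows "X_on (Suc (length s)) k *\<^sub>v ghz_vec b s = ghz_vec b (s[k - 1 := \<not> s ! (k - 1)])"
proof -
  obtain j where j: "k = Suc j" "j < length s" using k by (cases k) auto
  have "X_on (Suc (length s)) k *\<^sub>v ket (False # s) = ket (False # s[j := \<not> s ! j])"
    using X_on_ket[of k "False # s"] j by (simp)
  moreover have "X_on (Suc (length s)) k *\<^sub>v ket (True # map Not s) = ket (True # map Not (s[j := \<not> s ! j]))"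
    using X_on_ket[of k "True # map Not s"] j by (simp add: map_update)
  ultimately show ?thesis
    using j by (subst mult_ghz_vec[OF X_on_carrier]) (simp_all add: ghz_vec_def)
qed

lemma X_on_ghz:
  assumes "0 < k" "k \<le> length s"
  shows "X_on (Suc (length s)) k * ghz b s * X_on (Suc (length s)) k = ghz b (s[k - 1 := \<not> s ! (k - 1)])"
  using mult_proj_adjoint[OF X_on_carrier ghz_vec_carrier, of k s b] assms
  by (simp add: mat_adjoint_X_on X_on_ghz_vec ghz_def)

text \<open>Branches with different first bits are orthogonal, so only
  \<open>(1 + \<alpha> * \<beta>) / 2\<close> remains when \<open>s = t\<close>; this is 1 for equal
  phases and 0 for opposite ones.\<close>

lemma cscalar_prod_ghz_vec:
  assumes l: "length s = length t"
  shows "ghz_vec b s \<bullet>c ghz_vec c t = of_bool (b = c \<and> s = t)"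
proof -
  define d where "d = (2::nat) ^ Suc (length s)"
  define \<alpha> \<beta> :: complex where "\<alpha> = (-1) ^ of_bool b" and "\<beta> = (-1) ^ of_bool c"
  define p q p' q' where "p = ket (False # s)" and "q = ket (True # map Not s)"
    and "p' = ket (False # t)" and "q' = ket (True # map Not t)"
  have K: "p \<in> carrier_vec d" "q \<in> carrier_vec d" "p' \<in> carrier_vec d" "q' \<in> carrier_vec d"
    unfolding p_def q_def p'_def q'_def d_def by (metis ket_carrier length_Cons length_map l)+
  have "map Not s = map Not t \<longleftrightarrow> s = t" by (auto simp: inj_def dest: map_injective)
  hence P: "p \<bullet>c p' = of_bool (s = t)" "p \<bullet>c q' = 0" "q \<bullet>c p' = 0" "q \<bullet>c q' = of_bool (s = t)"
    unfolding p_def q_def p'_def q'_def using l by (simp_all add: cscalar_prod_ket)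
  have "ghz_vec b s \<bullet>c ghz_vec c t = (complex_of_real (1 / sqrt 2))\<^sup>2 *
      (p \<bullet>c p' + \<beta> * (p \<bullet>c q') + \<alpha> * (q \<bullet>c p') + \<alpha> * \<beta> * (q \<bullet>c q'))"
    unfolding ghz_vec_def p_def[symmetric] q_def[symmetric] p'_def[symmetric] q'_def[symmetric]
      \<alpha>_def[symmetric] \<beta>_def[symmetric]
    using K by (simp add: scalar_prod_def sum_distrib_left sum.distrib distrib_left distrib_right
        sum_divide_distrib power2_eq_square mult_ac \<beta>_def)
  also have "(complex_of_real (1 / sqrt 2))\<^sup>2 = 1 / 2"
    by (simp add: power_divide flip: of_real_power)
  finally show ?thesis
    unfolding P \<alpha>_def \<beta>_def by (cases b; cases c) auto
qed

lemma ghz_born_ghz: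
  assumes "length s = length t"
  shows "ghz_born (ghz b s) c t = of_bool (b = c \<and> s = t)"
proof -
  have "ghz_vec c t \<in> carrier_vec (2 ^ Suc (length s))"
    unfolding assms by (rule ghz_vec_carrier)
  from quadratic_form_proj[OF ghz_vec_carrier this, of b] show ?thesis
    unfolding ghz_born_def ghz_def by (simp only: cscalar_prod_ghz_vec[OF assms] Re_complex_of_real) simp
qed


section \<open>The two circuits\<close>

lemma hadamard_ket:
  "hadamard *\<^sub>v ket [b] = complex_of_real (1 / sqrt 2) \<cdot>\<^sub>v (ket [False] + ((-1) ^ of_bool b) \<cdot>\<^sub>v ket [True])"
  by (rule eq_vecI, cases b)
    (auto simp: ket_single hadamard_def mat_of_rows_list_def scalar_prod_def numeral_2_eq_2 less_Suc_eq)

lemma tensor_one_ket: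
  assumes "A \<in> carrier_mat 2 2"
  shows "(A \<otimes>\<^sub>m 1\<^sub>m (2 ^ length s)) *\<^sub>v ket (b # s) = (A *\<^sub>v ket [b]) \<otimes>\<^sub>v ket s"
proof -
  have "(A \<otimes>\<^sub>m 1\<^sub>m (2 ^ length s)) *\<^sub>v (ket [b] \<otimes>\<^sub>v ket s) = (A *\<^sub>v ket [b]) \<otimes>\<^sub>v (1\<^sub>m (2 ^ length s) *\<^sub>v ket s)"
    by (rule mult_tensor_mat_vec[OF assms one_carrier_mat ket_single_carrier ket_carrier])
  thus ?thesis by (simp add: one_mult_mat_vec flip: ket_Cons)
qed

lemma bell_circuit:
  "cnot *\<^sub>v ((hadamard \<otimes>\<^sub>m 1\<^sub>m 2) *\<^sub>v ket [False, False]) = ghz_vec False [False]"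
proof -
  have K: "ket [a, b] \<in> carrier_vec 4" for a b
    using ket_carrier[of "[a, b]"] by (simp)
  have "(hadamard \<otimes>\<^sub>m 1\<^sub>m 2) *\<^sub>v ket [False, False] =
      complex_of_real (1 / sqrt 2) \<cdot>\<^sub>v (ket [False, False] + ket [True, False])"
    using tensor_one_ket[OF gate_carrier(3), of "[False]" False]
    by (simp add: hadamard_ket tensor_vec_smult_left tensor_vec_add_left flip: ket_Cons)
  thus ?thesis
    using K by (simp add: mult_mat_vec[OF cnot_carrier] mult_add_distrib_mat_vec[OF cnot_carrier]
        cnot_ket ghz_vec_def)
qed

text \<open>Conjugation by \<open>H\<close> exchanges \<open>X\<close> and \<open>Z\<close>. The
  gate of the intermediate node is thus the one that the root applies to its own qubit, and one
  table of entries serves both.\<close>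

lemma hadamard_pauli_Z: "hadamard * pauli_Z = pauli_X * hadamard"
  by (rule eq_matI)
    (auto simp: hadamard_def pauli_X_def pauli_Z_def mat_of_rows_list_def scalar_prod_def
      numeral_2_eq_2 less_Suc_eq)

lemma index_pauli_X_hadamard:
  "(pauli_X * hadamard) $$ (0, 0) = complex_of_real (1 / sqrt 2)"
  "(pauli_X * hadamard) $$ (0, Suc 0) = - complex_of_real (1 / sqrt 2)"
  "(pauli_X * hadamard) $$ (Suc 0, 0) = complex_of_real (1 / sqrt 2)"
  "(pauli_X * hadamard) $$ (Suc 0, Suc 0) = complex_of_real (1 / sqrt 2)"
  by (simp_all add: hadamard_def pauli_X_def mat_of_rows_list_def scalar_prod_def numeral_2_eq_2)

lemma index_pauli_X_hadamard_pauli_X: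
  "(pauli_X * hadamard * pauli_X) $$ (0, 0) = - complex_of_real (1 / sqrt 2)"
  "(pauli_X * hadamard * pauli_X) $$ (0, Suc 0) = complex_of_real (1 / sqrt 2)"
  "(pauli_X * hadamard * pauli_X) $$ (Suc 0, 0) = complex_of_real (1 / sqrt 2)"
  "(pauli_X * hadamard * pauli_X) $$ (Suc 0, Suc 0) = complex_of_real (1 / sqrt 2)"
  by (simp_all add: hadamard_def pauli_X_def mat_of_rows_list_def scalar_prod_def numeral_2_eq_2)

lemma index_pauli_X:
  "pauli_X $$ (0, 0) = 0" "pauli_X $$ (0, Suc 0) = 1" "pauli_X $$ (Suc 0, 0) = 1" "pauli_X $$ (Suc 0, Suc 0) = 0"
  by (simp_all add: pauli_X_def mat_of_rows_list_def numeral_2_eq_2)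

lemma dim_gate [simp]:
  "dim_row pauli_X = 2" "dim_col pauli_X = 2" "dim_row hadamard = 2" "dim_col hadamard = 2"
  using gate_carrier[THEN carrier_matD(1)] gate_carrier[THEN carrier_matD(2)] by auto

lemma less_4_cases: "i < 4 \<longleftrightarrow> i = 0 \<or> i = 1 \<or> i = 2 \<or> i = 3" for i :: nat
  by auto

lemma sum_upto_4: "(\<Sum>i = 0..<4. f i) = f 0 + f 1 + f 2 + f (3::nat)" for f :: "nat \<Rightarrow> complex"
  by (simp add: eval_nat_numeral)

text \<open>Read in binary, the two branches \<open>[False, c]\<close> and
  \<open>[True, \<not> c]\<close> are the positions \<open>of_bool c\<close> and
  \<open>2 + of_bool (\<not> c)\<close>.\<close>

lemma index_ghz_vec_single:
  "i < 4 \<Longrightarrow> vec_index (ghz_vec b [c]) i = complex_of_real (1 / sqrt 2) *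
     (if i = of_bool c then 1 else if i = 2 + of_bool (\<not> c) then (-1) ^ of_bool b else 0)"
  unfolding less_4_cases
  by (auto simp: ghz_vec_def ket.simps(2))

lemmas two_qubit_simps = scalar_prod_def sum_upto_4 index_ghz_vec_single index_pauli_X_hadamard
  index_pauli_X_hadamard_pauli_X index_pauli_X less_4_cases

text \<open>The state that reaches the intermediate node, without (\<open>b = False\<close>) and with (\<open>b = True\<close>) a
  bit-flip in channel 0.\<close>

definition root_vec :: "bool \<Rightarrow> complex Matrix.vec" where
  "root_vec b = ((pauli_X * hadamard) \<otimes>\<^sub>m 1\<^sub>m 2) *\<^sub>v ghz_vec False [b]"

lemma dim_root_vec [simp]: "dim_vec (root_vec b) = 4"
  by (simp add: root_vec_def)

lemma root_vec_carrier [simp, intro]: "root_vec b \<in> carrier_vec 4"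
  by (rule carrier_vecI) simp

lemma complex_sqrt_2:
  "complex_of_real (sqrt 2) * complex_of_real (sqrt 2) = 2"
  "2 / complex_of_real (sqrt 2) = complex_of_real (sqrt 2)"
proof -
  show *: "complex_of_real (sqrt 2) * complex_of_real (sqrt 2) = 2"
    by (simp flip: of_real_mult)
  show "2 / complex_of_real (sqrt 2) = complex_of_real (sqrt 2)"
    by (simp add: field_simps *)
qed

text \<open>Each row of the gate meets exactly one nonzero entry of the Bell vector, so all entries
  are \<open>1 / 2\<close> up to sign. Only the place of the single minus sign depends on
  \<open>b\<close>.\<close>

lemma index_root_vec:
  "i < 4 \<Longrightarrow> vec_index (root_vec b) i = (if i = of_bool (\<not> b) then - 1 / 2 else 1 / 2)"
  unfolding less_4_cases root_vec_def
  by (cases b) (auto simp: two_qubit_simps complex_sqrt_2)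

text \<open>On a Bell vector of phase 0, \<open>X\<close> on the first qubit has the same effect as
  \<open>X\<close> on the second, so the rightmost \<open>X\<close> merely exchanges the two inputs
  of \<open>XH\<close>.\<close>

lemma XHX_ghz_vec:
  "((pauli_X * hadamard * pauli_X) \<otimes>\<^sub>m 1\<^sub>m 2) *\<^sub>v ghz_vec False [b] = root_vec (\<not> b)"
proof (rule eq_vecI)
  fix i assume "i < dim_vec (root_vec (\<not> b))"
  thus "vec_index (((pauli_X * hadamard * pauli_X) \<otimes>\<^sub>m 1\<^sub>m 2) *\<^sub>v ghz_vec False [b]) i =
      vec_index (root_vec (\<not> b)) i"
    unfolding dim_root_vec less_4_cases
    by (cases b) (auto simp: index_root_vec two_qubit_simps complex_sqrt_2)
qed simp

text \<open>The flip acts on the transmitted qubit and commutes with the root's gate on the kept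
  one.\<close>

lemma X_on_root_vec: "X_on 2 1 *\<^sub>v root_vec b = root_vec (\<not> b)"
proof (rule eq_vecI)
  fix i assume "i < dim_vec (root_vec (\<not> b))"
  thus "vec_index (X_on 2 1 *\<^sub>v root_vec b) i = vec_index (root_vec (\<not> b)) i"
    unfolding dim_root_vec less_4_cases
    by (cases b) (auto simp: index_root_vec two_qubit_simps X_on_def)
qed (simp add: X_on_def)

text \<open>Here the bit of the Bell vector becomes a phase. The sign comes from the
  \<open>-Z\<close> into which the flip is conjugated; the four entries are compared
  directly.\<close>

lemma intermediate_gate_root_vec:
  "(1\<^sub>m 2 \<otimes>\<^sub>m (hadamard * pauli_Z)) *\<^sub>v root_vec b = (-1) ^ of_bool b \<cdot>\<^sub>v ghz_vec b [False]"
proof (rule eq_vecI)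
  fix i assume "i < dim_vec ((-1) ^ of_bool b \<cdot>\<^sub>v ghz_vec b [False])"
  hence "i < 4" by simp
  thus "vec_index ((1\<^sub>m 2 \<otimes>\<^sub>m (hadamard * pauli_Z)) *\<^sub>v root_vec b) i =
      vec_index ((-1) ^ of_bool b \<cdot>\<^sub>v ghz_vec b [False]) i"
    unfolding less_4_cases hadamard_pauli_Z
    by (cases b) (auto simp: index_root_vec two_qubit_simps simp del: index_mult_mat(1))
qed (simp add: hadamard_pauli_Z)

text \<open>Disposes of the sign just obtained: it is a global phase, invisible in the density
  matrix.\<close>

lemma proj_phase: "k * cnj k = 1 \<Longrightarrow> proj (k \<cdot>\<^sub>v v) = proj v"
  by (rule eq_matI) (auto simp: algebra_simps)

lemma sign_times_cnj: "(-1) ^ of_bool b * cnj ((-1) ^ of_bool b) = 1"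
  by (cases b) auto

lemma run_root_circuit:
  assumes "V \<in> carrier_mat 2 2"
  shows "run_circuit (root_circuit V) (proj (ket [False, False])) = proj ((V \<otimes>\<^sub>m 1\<^sub>m 2) *\<^sub>v ghz_vec False [False])"
proof -
  have "set (root_circuit V) \<subseteq> carrier_mat 4 4"
    using assms cnot_carrier by (auto simp: root_circuit_def intro!: carrier_matI)
  moreover have "ket [False, False] \<in> carrier_vec 4"
    by (rule carrier_vecI) simp
  ultimately have "run_circuit (root_circuit V) (proj (ket [False, False])) =
      proj (fold (*\<^sub>v) (root_circuit V) (ket [False, False]))"
    by (rule run_circuit_proj)
  thus ?thesis
    by (simp add: root_circuit_def bell_circuit)
qed

lemma bit_flip_channel_received:
  assumes "v \<in> carrier_vec 4" "X_on 2 1 *\<^sub>v v = w"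
  shows "bit_flip_channels \<theta> 0 2 1 (proj v) = \<theta> 0 \<cdot>\<^sub>m proj v + (1 - \<theta> 0) \<cdot>\<^sub>m proj w"
  using mult_proj_adjoint[of "X_on 2 1" 4 4 v] assms X_on_carrier[of 1 2]
  by (simp add: bit_flip_channels_def mat_adjoint_X_on)

lemma received_state_bell:
  "received_state [hadamard \<otimes>\<^sub>m 1\<^sub>m 2, cnot] (bit_flip_channels \<theta>) =
     \<theta> 0 \<cdot>\<^sub>m ghz False [False] + (1 - \<theta> 0) \<cdot>\<^sub>m ghz False [True]"
proof -
  have "set [hadamard \<otimes>\<^sub>m 1\<^sub>m 2, cnot] \<subseteq> carrier_mat 4 4"
    using cnot_carrier by (auto intro!: carrier_matI)
  moreover have "ket [False, False] \<in> carrier_vec 4"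
    by (rule carrier_vecI) simp
  ultimately have "run_circuit [hadamard \<otimes>\<^sub>m 1\<^sub>m 2, cnot] (proj (ket [False, False])) =
      proj (fold (*\<^sub>v) [hadamard \<otimes>\<^sub>m 1\<^sub>m 2, cnot] (ket [False, False]))"
    by (rule run_circuit_proj)
  also have "\<dots> = proj (ghz_vec False [False])"
    by (simp add: bell_circuit)
  finally have "run_circuit [hadamard \<otimes>\<^sub>m 1\<^sub>m 2, cnot] (proj (ket [False, False])) = proj (ghz_vec False [False])" .
  moreover have "X_on 2 1 *\<^sub>v ghz_vec False [False] = ghz_vec False [True]"
    using X_on_ghz_vec[of 1 "[False]" False] by (simp add: numeral_2_eq_2)
  moreover have "ghz_vec False [False] \<in> carrier_vec 4"
    by (rule carrier_vecI) simp
  ultimately show ?thesis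
    unfolding received_state_def ghz_def by (simp only: bit_flip_channel_received)
qed

text \<open>The root's last gate acts on the kept qubit, so it may be moved past channel 0. This
  isolates what the two local gates do to the mixture that a bare Bell pair would produce.\<close>

lemma run_two_qubit_circuit:
  "run_circuit [(pauli_X * hadamard) \<otimes>\<^sub>m 1\<^sub>m 2, 1\<^sub>m 2 \<otimes>\<^sub>m (hadamard * pauli_Z)]
     (a \<cdot>\<^sub>m ghz False [False] + b \<cdot>\<^sub>m ghz False [True]) =
   a \<cdot>\<^sub>m ghz False [False] + b \<cdot>\<^sub>m ghz True [False]"
proof -
  let ?C = "[(pauli_X * hadamard) \<otimes>\<^sub>m 1\<^sub>m 2, 1\<^sub>m 2 \<otimes>\<^sub>m (hadamard * pauli_Z)]"
  have C: "set ?C \<subseteq> carrier_mat 4 4"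
    by (auto simp: hadamard_pauli_Z intro!: carrier_matI)
  have v: "ghz_vec False [c] \<in> carrier_vec 4" for c
    by (rule carrier_vecI) simp
  have "run_circuit ?C (proj (ghz_vec False [c])) = ghz c [False]" for c
    using run_circuit_proj[OF C v] proj_phase[OF sign_times_cnj]
    by (simp add: ghz_def intermediate_gate_root_vec flip: root_vec_def)
  moreover have "ghz False [c] \<in> carrier_mat 4 4" for c
    unfolding ghz_def using v by (rule proj_carrier)
  ultimately show ?thesis
    using run_circuit_mixture[OF C] by (simp flip: ghz_def)
qed

lemma tensor_mat_mixture_left:
  assumes "A \<in> carrier_mat a b" "B \<in> carrier_mat a b"
  shows "(x \<cdot>\<^sub>m A + y \<cdot>\<^sub>m B) \<otimes>\<^sub>m C = x \<cdot>\<^sub>m (A \<otimes>\<^sub>m C) + y \<cdot>\<^sub>m (B \<otimes>\<^sub>m C)"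
  using assms by (intro eq_matI) (auto simp: div_less_of_less_mult algebra_simps)

lemma intermediate_circuit_carrier:
  assumes "n \<ge> 2"
  shows "set (map (\<lambda>U. 1\<^sub>m 2 \<otimes>\<^sub>m U) (intermediate_circuit n)) \<subseteq> carrier_mat (2 ^ n) (2 ^ n)"
proof -
  \<comment> \<open>\<open>k\<close> is the number of register qubits; it is 0 in the smallest
    network.\<close>
  obtain k where n: "n = Suc (Suc k)" using assms by (metis add_2_eq_Suc le_Suc_ex)
  have "toffoli (Suc k) \<in> carrier_mat (2 ^ Suc k) (2 ^ Suc k)" by blast
  thus ?thesis
    unfolding n
    by (auto simp: intermediate_circuit_def hadamard_pauli_Z intro!: carrier_matI)
qed

lemma intermediate_step_mixture:
  assumes n: "n \<ge> 2" and A: "A \<in> carrier_mat 4 4" and B: "B \<in> carrier_mat 4 4"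
  shows "intermediate_step n (intermediate_circuit n) (x \<cdot>\<^sub>m A + y \<cdot>\<^sub>m B) =
    x \<cdot>\<^sub>m intermediate_step n (intermediate_circuit n) A + y \<cdot>\<^sub>m intermediate_step n (intermediate_circuit n) B"
proof -
  obtain k where k: "n = Suc (Suc k)" using n by (metis add_2_eq_Suc le_Suc_ex)
  let ?K = "proj (ket (replicate (n - 2) False))"
  have "A \<otimes>\<^sub>m ?K \<in> carrier_mat (2 ^ n) (2 ^ n)" "B \<otimes>\<^sub>m ?K \<in> carrier_mat (2 ^ n) (2 ^ n)"
    using A B by (auto simp: k intro!: carrier_matI)
  thus ?thesis
    unfolding intermediate_step_def tensor_mat_mixture_left[OF A B]
    by (intro run_circuit_mixture[OF intermediate_circuit_carrier[OF n]])
qed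

text \<open>In both branches the received qubit, which is the control, agrees with the root's qubit.
  The register zeros therefore stay zeros in one branch and all become ones in the other.\<close>

lemma toffoli_ghz_vec:
  "(1\<^sub>m 2 \<otimes>\<^sub>m toffoli (Suc k)) *\<^sub>v (ghz_vec b [False] \<otimes>\<^sub>v ket (replicate k False)) =
    ghz_vec b (replicate (Suc k) False)"
proof -
  let ?r = "replicate k False" and ?c = "complex_of_real (1 / sqrt 2)"
  define U where "U = 1\<^sub>m 2 \<otimes>\<^sub>m toffoli (Suc k)"
  have T: "toffoli (Suc k) \<in> carrier_mat (2 ^ Suc k) (2 ^ Suc k)" by blast
  hence U: "U \<in> carrier_mat (2 ^ Suc (Suc k)) (2 ^ Suc (Suc k))"
    by (auto simp: U_def intro!: carrier_matI)
  have K: "ket (a # c # ?r) \<in> carrier_vec (2 ^ Suc (Suc k))" for a c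
    by (rule carrier_vecI) simp
  have U_ket: "U *\<^sub>v ket (a # c # ?r) = ket (a # c # (if c then map Not ?r else ?r))" for a c
  proof -
    have "ket (c # ?r) \<in> carrier_vec (2 ^ Suc k)" by (rule carrier_vecI) simp
    hence "U *\<^sub>v (ket [a] \<otimes>\<^sub>v ket (c # ?r)) = ket [a] \<otimes>\<^sub>v (toffoli (Suc k) *\<^sub>v ket (c # ?r))"
      unfolding U_def by (subst mult_tensor_mat_vec[OF one_carrier_mat T ket_single_carrier]) simp_all
    also have "toffoli (Suc k) *\<^sub>v ket (c # ?r) = ket (c # (if c then map Not ?r else ?r))"
      using toffoli_ket[of ?r c] by simp
    finally show ?thesis by (simp only: flip: ket_Cons)
  qed
  have "ghz_vec b [False] \<otimes>\<^sub>v ket ?r =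
      ?c \<cdot>\<^sub>v (ket (False # False # ?r) + ((-1) ^ of_bool b) \<cdot>\<^sub>v ket (True # True # ?r))"
    unfolding ghz_vec_def
    by (simp add: tensor_vec_smult_left tensor_vec_add_left flip: ket_append)
  thus ?thesis
    using K by (simp add: mult_mat_vec[OF U] mult_add_distrib_mat_vec[OF U] U_ket ghz_vec_def flip: U_def)
qed

lemma intermediate_step_root_vec:
  assumes n: "n \<ge> 2"
  shows "intermediate_step n (intermediate_circuit n) (proj (root_vec b)) = ghz b (replicate (n - 1) False)"
proof -
  obtain k where k: "n = Suc (Suc k)" using n by (metis add_2_eq_Suc le_Suc_ex)
  let ?r = "replicate k False"
  have r: "ket ?r \<in> carrier_vec (2 ^ k)" by (rule carrier_vecI) simp
  have G: "1\<^sub>m 2 \<otimes>\<^sub>m (hadamard * pauli_Z) \<in> carrier_mat 4 4"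
    by (rule carrier_matI) (simp_all add: hadamard_pauli_Z)
  have "(1\<^sub>m 2 \<otimes>\<^sub>m (hadamard * pauli_Z) \<otimes>\<^sub>m 1\<^sub>m (2 ^ k)) *\<^sub>v (root_vec b \<otimes>\<^sub>v ket ?r) =
      ((-1) ^ of_bool b \<cdot>\<^sub>v ghz_vec b [False]) \<otimes>\<^sub>v ket ?r"
    \<comment> \<open>Regrouped so that the gate on the received qubit acts on the two-qubit vector
      and the identity on the register.\<close>
    unfolding tensor_mat_assoc[symmetric]
    by (subst mult_tensor_mat_vec[OF G one_carrier_mat root_vec_carrier r])
      (simp add: intermediate_gate_root_vec one_mult_mat_vec[OF r])
  moreover have "(1\<^sub>m 2 \<otimes>\<^sub>m toffoli (Suc k)) *\<^sub>v (((-1) ^ of_bool b \<cdot>\<^sub>v ghz_vec b [False]) \<otimes>\<^sub>v ket ?r) =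
      (-1) ^ of_bool b \<cdot>\<^sub>v ghz_vec b (replicate (Suc k) False)"
  proof -
    have "toffoli (Suc k) \<in> carrier_mat (2 ^ Suc k) (2 ^ Suc k)" by blast
    hence U: "1\<^sub>m 2 \<otimes>\<^sub>m toffoli (Suc k) \<in> carrier_mat (2 ^ Suc (Suc k)) (2 ^ Suc (Suc k))"
      by (auto intro!: carrier_matI)
    have "ghz_vec b [False] \<otimes>\<^sub>v ket ?r \<in> carrier_vec (2 ^ Suc (Suc k))"
      by (rule carrier_vecI) simp
    thus ?thesis
      unfolding tensor_vec_smult_left by (simp only: mult_mat_vec[OF U] toffoli_ghz_vec)
  qed
  moreover have "root_vec b \<otimes>\<^sub>v ket ?r \<in> carrier_vec (2 ^ n)"
    by (rule carrier_vecI) (simp add: k)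
  ultimately show ?thesis
    using run_circuit_proj[OF intermediate_circuit_carrier[OF n], of "root_vec b \<otimes>\<^sub>v ket ?r"]
      proj_phase[OF sign_times_cnj]
    by (simp add: intermediate_step_def intermediate_circuit_def proj_tensor ghz_def k del: replicate_Suc)
qed

lemma pauli_X_hadamard_carrier: "pauli_X * hadamard \<in> carrier_mat 2 2"
  "pauli_X * hadamard * pauli_X \<in> carrier_mat 2 2"
  by (auto intro!: carrier_matI)

lemma received_state_root:
  "received_state (root_circuit (pauli_X * hadamard)) (bit_flip_channels \<theta>) =
    \<theta> 0 \<cdot>\<^sub>m proj (root_vec False) + (1 - \<theta> 0) \<cdot>\<^sub>m proj (root_vec True)"
  using bit_flip_channel_received[OF root_vec_carrier X_on_root_vec, of \<theta> False]
  by (simp add: received_state_def run_root_circuit[OF pauli_X_hadamard_carrier(1)] flip: root_vec_def)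

text \<open>With \<open>XHX\<close> the unflipped case already starts from
  \<open>root_vec True\<close>, so the two weights trade places.\<close>

lemma received_state_root_XHX:
  "received_state (root_circuit (pauli_X * hadamard * pauli_X)) (bit_flip_channels \<theta>) =
    \<theta> 0 \<cdot>\<^sub>m proj (root_vec True) + (1 - \<theta> 0) \<cdot>\<^sub>m proj (root_vec False)"
  using bit_flip_channel_received[OF root_vec_carrier X_on_root_vec, of \<theta> True]
  by (simp add: received_state_def run_root_circuit[OF pauli_X_hadamard_carrier(2)] XHX_ghz_vec)

lemma received_state_flip_pattern:
  "received_state (root_circuit (pauli_X * hadamard)) (flip_pattern e) = proj (root_vec (e 0))"
  using mult_proj_adjoint[of "X_on 2 1" 4 4 "root_vec False"] X_on_carrier[of 1 2]
  by (simp add: received_state_def run_root_circuit[OF pauli_X_hadamard_carrier(1)] flip_pattern_def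
      mat_adjoint_X_on X_on_root_vec[simplified] flip: root_vec_def)


section \<open>Transmission to the end-nodes\<close>

lemma bit_flip_channels_carrier:
  assumes "k < m" "A \<in> carrier_mat (2 ^ m) (2 ^ m)"
  shows "bit_flip_channels \<theta> j m k A \<in> carrier_mat (2 ^ m) (2 ^ m)"
  using X_on_carrier[OF assms(1)] assms(2) by (simp add: bit_flip_channels_def)

lemma bit_flip_channels_mixture:
  assumes k: "k < m" and A: "A \<in> carrier_mat (2 ^ m) (2 ^ m)" and B: "B \<in> carrier_mat (2 ^ m) (2 ^ m)"
  shows "bit_flip_channels \<theta> j m k (a \<cdot>\<^sub>m A + b \<cdot>\<^sub>m B) =
    a \<cdot>\<^sub>m bit_flip_channels \<theta> j m k A + b \<cdot>\<^sub>m bit_flip_channels \<theta> j m k B"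
proof -
  note X = X_on_carrier[OF k]
  have "X_on m k * A * X_on m k \<in> carrier_mat (2 ^ m) (2 ^ m)"
    "X_on m k * B * X_on m k \<in> carrier_mat (2 ^ m) (2 ^ m)"
    using X A B by simp_all
  thus ?thesis
    unfolding bit_flip_channels_def sandwich_mixture[OF X X A B] using A B
    by (intro eq_matI) (simp_all add: algebra_simps del: index_mult_mat)
qed

lemma fold_bit_flip_channels_mixture:
  assumes "set js \<subseteq> {..<m}" "A \<in> carrier_mat (2 ^ m) (2 ^ m)" "B \<in> carrier_mat (2 ^ m) (2 ^ m)"
  shows "fold (\<lambda>j. bit_flip_channels \<theta> j m j) js (a \<cdot>\<^sub>m A + b \<cdot>\<^sub>m B) =
    a \<cdot>\<^sub>m fold (\<lambda>j. bit_flip_channels \<theta> j m j) js A + b \<cdot>\<^sub>m fold (\<lambda>j. bit_flip_channels \<theta> j m j) js B"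
  using assms
  by (induction js arbitrary: A B) (simp_all add: bit_flip_channels_mixture bit_flip_channels_carrier)

lemma bit_flip_channels_mat_sum:
  assumes k: "k < m" and f: "\<And>s. s \<in> S \<Longrightarrow> f s \<in> carrier_mat (2 ^ m) (2 ^ m)"
  shows "bit_flip_channels \<theta> j m k (mat_sum (2 ^ m) f S) =
    mat_sum (2 ^ m) (\<lambda>s. bit_flip_channels \<theta> j m k (f s)) S"
proof -
  note X = X_on_carrier[OF k]
  have "X_on m k * f s * X_on m k \<in> carrier_mat (2 ^ m) (2 ^ m)" if "s \<in> S" for s
    using X f[OF that] by simp
  thus ?thesis
    unfolding bit_flip_channels_def using f
    by (simp add: sandwich_mat_sum[OF X X] mat_sum_mixture)
qed

lemma smult_smult_mat: "a \<cdot>\<^sub>m (b \<cdot>\<^sub>m A) = (a * b) \<cdot>\<^sub>m A"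
  for A :: "'a :: semigroup_mult Matrix.mat"
  by (rule eq_matI) (simp_all add: mult.assoc)

lemma bit_flip_channels_smult_ghz:
  assumes "length s = l" "0 < k" "k \<le> l"
  shows "bit_flip_channels \<theta> j (Suc l) k (w \<cdot>\<^sub>m ghz b s) =
    (w * \<theta> j) \<cdot>\<^sub>m ghz b s + (w * (1 - \<theta> j)) \<cdot>\<^sub>m ghz b (s[k - 1 := \<not> s ! (k - 1)])"
proof -
  let ?X = "X_on (Suc l) k" and ?t = "s[k - 1 := \<not> s ! (k - 1)]"
  have X: "?X \<in> carrier_mat (2 ^ Suc l) (2 ^ Suc l)"
    by (rule X_on_carrier) (use assms in simp)
  have G: "ghz b s \<in> carrier_mat (2 ^ Suc l) (2 ^ Suc l)" "ghz b ?t \<in> carrier_mat (2 ^ Suc l) (2 ^ Suc l)"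
    using assms(1) ghz_carrier[of b s] ghz_carrier[of b ?t] by (simp_all only: length_list_update)
  have "?X * ghz b s * ?X = ghz b ?t"
    using X_on_ghz[of k s b] assms by blast
  hence "?X * (w \<cdot>\<^sub>m ghz b s) * ?X = w \<cdot>\<^sub>m ghz b ?t"
    by (simp only: mult_smult_distrib[OF X G(1)] mult_smult_assoc_mat[OF mult_carrier_mat[OF X G(1)] X])
  hence "bit_flip_channels \<theta> j (Suc l) k (w \<cdot>\<^sub>m ghz b s) =
      \<theta> j \<cdot>\<^sub>m (w \<cdot>\<^sub>m ghz b s) + complex_of_real (1 - \<theta> j) \<cdot>\<^sub>m (w \<cdot>\<^sub>m ghz b ?t)"
    by (simp only: bit_flip_channels_def)
  also have "\<dots> = (w * \<theta> j) \<cdot>\<^sub>m ghz b s + (w * (1 - \<theta> j)) \<cdot>\<^sub>m ghz b ?t"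
    by (simp only: smult_smult_mat of_real_mult mult.commute)
  finally show ?thesis .
qed

section \<open>Weights of the flip patterns\<close>

lemma finite_bool_lists: "finite {s :: bool list. length s = k}"
  using finite_lists_length_eq[of "UNIV :: bool set" k] by simp

text \<open>The last bit is split off because the channels act in increasing order: channel
  \<open>k + 1\<close> decides the bit appended to a string of length \<open>k\<close>.\<close>

lemma sum_length_Suc:
  "(\<Sum>s | length s = Suc k. f s) = (\<Sum>s | length s = k. f (s @ [False]) + f (s @ [True]))"
  for f :: "bool list \<Rightarrow> 'a :: comm_monoid_add"
proof -
  have "(\<Sum>s | length s = k. f (s @ [False]) + f (s @ [True])) =
      (\<Sum>s | length s = k. \<Sum>b\<in>UNIV. f (s @ [b]))"
    by (simp add: UNIV_bool)
  also have "\<dots> = (\<Sum>(s, b) \<in> {s. length s = k} \<times> UNIV. f (s @ [b]))"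
    by (simp add: sum.cartesian_product finite_bool_lists)
  also have "\<dots> = (\<Sum>s | length s = Suc k. f s)"
    by (rule sum.reindex_bij_witness[where i = "\<lambda>s. (butlast s, last s)" and j = "\<lambda>(s, b). s @ [b]"])
      (auto simp: append_butlast_last_id length_Suc_conv_rev)
  finally show ?thesis ..
qed

lemma beta0_alt: "beta0 n \<theta> s = (\<Prod>j = 1..<n. if s ! (j - 1) then 1 - \<theta> j else \<theta> j)"
proof -
  have "{j \<in> {1..<n}. s ! (j - 1)} = {1..<n} \<inter> {j. s ! (j - 1)}"
    "{j \<in> {1..<n}. \<not> s ! (j - 1)} = {1..<n} \<inter> - {j. s ! (j - 1)}" by auto
  thus ?thesis by (simp add: beta0_def prod.If_cases mult.commute)
qed

lemma beta0_snoc: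
  assumes "length s = k"
  shows "beta0 (Suc (Suc k)) \<theta> (s @ [b]) = beta0 (Suc k) \<theta> s * (if b then 1 - \<theta> (Suc k) else \<theta> (Suc k))"
proof -
  have "(\<Prod>j = 1..<Suc k. if (s @ [b]) ! (j - 1) then 1 - \<theta> j else \<theta> j) =
      (\<Prod>j = 1..<Suc k. if s ! (j - 1) then 1 - \<theta> j else \<theta> j)"
    using assms by (intro prod.cong) (auto simp: nth_append)
  thus ?thesis using assms by (simp add: beta0_alt nth_append)
qed

lemma beta1_eq_beta0:
  assumes "length s = n - 1"
  shows "beta1 n \<theta> s = beta0 n \<theta> (map Not s)"
proof -
  have "{j \<in> {1..<n}. s ! (j - 1)} = {j \<in> {1..<n}. \<not> map Not s ! (j - 1)}"
    "{j \<in> {1..<n}. \<not> s ! (j - 1)} = {j \<in> {1..<n}. map Not s ! (j - 1)}"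
    using assms by auto
  thus ?thesis by (simp add: beta0_def beta1_def)
qed

text \<open>The two extensions of a string share its weight in the proportions
  \<open>\<theta>\<close> and \<open>1 - \<theta>\<close>, so the total never changes.\<close>

lemma sum_beta0: "(\<Sum>s | length s = k. beta0 (Suc k) \<theta> s) = 1"
proof (induction k)
  case (Suc k)
  have "(\<Sum>s | length s = Suc k. beta0 (Suc (Suc k)) \<theta> s) =
      (\<Sum>s | length s = k. beta0 (Suc k) \<theta> s * \<theta> (Suc k) + beta0 (Suc k) \<theta> s * (1 - \<theta> (Suc k)))"
    unfolding sum_length_Suc by (rule sum.cong) (simp_all add: beta0_snoc)
  also have "\<dots> = (\<Sum>s | length s = k. beta0 (Suc k) \<theta> s)"
    by (simp add: algebra_simps)
  finally show ?case using Suc by simp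
qed (simp add: beta0_def)

text \<open>Induction on the number \<open>k\<close> of channels already passed, with
  \<open>l\<close> fixed: the first \<open>k\<close> bits are mixed and the others are still
  \<open>False\<close>. The next channel splits each term into the two extensions of its string,
  weighted as in \<open>beta0_snoc\<close>.\<close>

lemma fold_bit_flip_channels_ghz:
  "k \<le> l \<Longrightarrow> fold (\<lambda>j. bit_flip_channels \<theta> j (Suc l) j) [1..<Suc k] (ghz b (replicate l False)) =
    mat_sum (2 ^ Suc l) (\<lambda>s. beta0 (Suc k) \<theta> s \<cdot>\<^sub>m ghz b (s @ replicate (l - k) False)) {s. length s = k}"
proof (induction k)
  case 0
  show ?case
    using ghz_carrier[of b "replicate l False"] by (intro eq_matI) (auto simp: beta0_def)
next
  case (Suc k)
  let ?r = "replicate (l - Suc k) False" and ?E = "bit_flip_channels \<theta> (Suc k) (Suc l) (Suc k)"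
  have r: "replicate (l - k) False = False # ?r"
    using Suc.prems by (metis Suc_diff_Suc Suc_le_eq replicate_Suc)
  have G: "ghz b t \<in> carrier_mat (2 ^ Suc l) (2 ^ Suc l)" if "length t = l" for t
    using ghz_carrier[of b t] that by simp
  have "fold (\<lambda>j. bit_flip_channels \<theta> j (Suc l) j) [1..<Suc (Suc k)] (ghz b (replicate l False)) =
      ?E (mat_sum (2 ^ Suc l) (\<lambda>s. beta0 (Suc k) \<theta> s \<cdot>\<^sub>m ghz b (s @ replicate (l - k) False)) {s. length s = k})"
    using Suc by simp
  also have "\<dots> = mat_sum (2 ^ Suc l)
      (\<lambda>s. ?E (beta0 (Suc k) \<theta> s \<cdot>\<^sub>m ghz b (s @ replicate (l - k) False))) {s. length s = k}"
    using Suc.prems by (intro bit_flip_channels_mat_sum smult_carrier_mat G) simp_all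
  also have "\<dots> = mat_sum (2 ^ Suc l)
      (\<lambda>s. beta0 (Suc (Suc k)) \<theta> (s @ [False]) \<cdot>\<^sub>m ghz b ((s @ [False]) @ ?r) +
        beta0 (Suc (Suc k)) \<theta> (s @ [True]) \<cdot>\<^sub>m ghz b ((s @ [True]) @ ?r)) {s. length s = k}"
  proof (rule mat_sum_cong)
    fix s :: "bool list" assume "s \<in> {s. length s = k}"
    hence s: "length s = k" by simp
    show "?E (beta0 (Suc k) \<theta> s \<cdot>\<^sub>m ghz b (s @ replicate (l - k) False)) =
        beta0 (Suc (Suc k)) \<theta> (s @ [False]) \<cdot>\<^sub>m ghz b ((s @ [False]) @ ?r) +
        beta0 (Suc (Suc k)) \<theta> (s @ [True]) \<cdot>\<^sub>m ghz b ((s @ [True]) @ ?r)"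
      using s Suc.prems unfolding r
      by (subst bit_flip_channels_smult_ghz) (auto simp: beta0_snoc[OF s] nth_append list_update_append)
  qed
  also have "\<dots> = mat_sum (2 ^ Suc l) (\<lambda>s. beta0 (Suc (Suc k)) \<theta> s \<cdot>\<^sub>m ghz b (s @ ?r)) {s. length s = Suc k}"
  \<comment> \<open>\<open>sum_length_Suc\<close> speaks of sums in a type, hence the passage to
    entries.\<close>
  proof (rule eq_matI)
    fix i j
    assume "i < dim_row (mat_sum (2 ^ Suc l) (\<lambda>s. beta0 (Suc (Suc k)) \<theta> s \<cdot>\<^sub>m ghz b (s @ ?r)) {s. length s = Suc k})"
      "j < dim_col (mat_sum (2 ^ Suc l) (\<lambda>s. beta0 (Suc (Suc k)) \<theta> s \<cdot>\<^sub>m ghz b (s @ ?r)) {s. length s = Suc k})"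
    hence ij: "i < 2 ^ Suc l" "j < 2 ^ Suc l" by simp_all
    have D: "dim_row (ghz b t) = 2 ^ Suc l" "dim_col (ghz b t) = 2 ^ Suc l" if "length t = l" for t
      using G[OF that] by auto
    show "mat_sum (2 ^ Suc l)
        (\<lambda>s. beta0 (Suc (Suc k)) \<theta> (s @ [False]) \<cdot>\<^sub>m ghz b ((s @ [False]) @ ?r) +
          beta0 (Suc (Suc k)) \<theta> (s @ [True]) \<cdot>\<^sub>m ghz b ((s @ [True]) @ ?r)) {s. length s = k} $$ (i, j) =
        mat_sum (2 ^ Suc l) (\<lambda>s. beta0 (Suc (Suc k)) \<theta> s \<cdot>\<^sub>m ghz b (s @ ?r)) {s. length s = Suc k} $$ (i, j)"
      unfolding index_mat_sum[OF ij] sum_length_Suc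
      using ij Suc.prems by (intro sum.cong refl) (simp add: D)
  qed simp_all
  finally show ?case .
qed

lemma fold_flip_pattern_ghz:
  "k \<le> l \<Longrightarrow> fold (\<lambda>j. flip_pattern e j (Suc l) j) [1..<Suc k] (ghz b (replicate l False)) =
    ghz b (map e [1..<Suc k] @ replicate (l - k) False)"
proof (induction k)
  case (Suc k)
  have r: "replicate (l - k) False = False # replicate (l - Suc k) False"
    using Suc.prems by (metis Suc_diff_Suc Suc_le_eq replicate_Suc)
  let ?s = "map e [1..<Suc k] @ replicate (l - k) False"
  have "fold (\<lambda>j. flip_pattern e j (Suc l) j) [1..<Suc (Suc k)] (ghz b (replicate l False)) =
      flip_pattern e (Suc k) (Suc l) (Suc k) (ghz b ?s)"
    using Suc by simp
  also have "\<dots> = ghz b (if e (Suc k) then ?s[k := \<not> ?s ! k] else ?s)"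
    using X_on_ghz[of "Suc k" ?s b] Suc.prems by (simp add: flip_pattern_def del: upt_Suc)
  also have "(if e (Suc k) then ?s[k := \<not> ?s ! k] else ?s) =
      map e [1..<Suc (Suc k)] @ replicate (l - Suc k) False"
    unfolding r by (simp add: nth_append list_update_append)
  finally show ?case .
qed simp

text \<open>The weights \<open>a\<close>, \<open>b\<close> and the phases \<open>c\<close>,
  \<open>d\<close> are left open to serve both root circuits, with \<open>XH\<close> and with
  \<open>XHX\<close>.\<close>

lemma distributed_state_bit_flip_channels:
  assumes n: "n \<ge> 2"
    and rec: "received_state C (bit_flip_channels \<theta>) = a \<cdot>\<^sub>m proj (root_vec c) + b \<cdot>\<^sub>m proj (root_vec d)"
  shows "distributed_state n C (intermediate_circuit n) (bit_flip_channels \<theta>) =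
    mat_sum (2 ^ n) (\<lambda>s. (a * beta0 n \<theta> s) \<cdot>\<^sub>m ghz c s + (b * beta0 n \<theta> s) \<cdot>\<^sub>m ghz d s) {s. length s = n - 1}"
proof -
  obtain l where l: "n = Suc l" using n by (cases n) auto
  have G: "ghz c t \<in> carrier_mat (2 ^ n) (2 ^ n)" if "length t = n - 1" for c t
    using ghz_carrier[of c t] that l by simp
  have P: "proj (root_vec c) \<in> carrier_mat 4 4" for c by blast
  have F: "fold (\<lambda>j. bit_flip_channels \<theta> j n j) [1..<n] (ghz c (replicate (n - 1) False)) =
      mat_sum (2 ^ n) (\<lambda>s. beta0 n \<theta> s \<cdot>\<^sub>m ghz c s) {s. length s = n - 1}" for c
    using fold_bit_flip_channels_ghz[of l l \<theta> c] by (simp add: l)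
  have "distributed_state n C (intermediate_circuit n) (bit_flip_channels \<theta>) =
      a \<cdot>\<^sub>m mat_sum (2 ^ n) (\<lambda>s. beta0 n \<theta> s \<cdot>\<^sub>m ghz c s) {s. length s = n - 1} +
      b \<cdot>\<^sub>m mat_sum (2 ^ n) (\<lambda>s. beta0 n \<theta> s \<cdot>\<^sub>m ghz d s) {s. length s = n - 1}"
    unfolding distributed_state_def rec intermediate_step_mixture[OF n P P] intermediate_step_root_vec[OF n]
    by (subst fold_bit_flip_channels_mixture) (auto simp: F[unfolded One_nat_def] intro!: G)
  also have "\<dots> = mat_sum (2 ^ n) (\<lambda>s. a \<cdot>\<^sub>m (beta0 n \<theta> s \<cdot>\<^sub>m ghz c s) + b \<cdot>\<^sub>m (beta0 n \<theta> s \<cdot>\<^sub>m ghz d s))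
      {s. length s = n - 1}"
    by (rule mat_sum_mixture) (simp_all add: G)
  finally show ?thesis by (simp add: smult_smult_mat)
qed

lemma distributed_state_flip_pattern:
  assumes n: "n \<ge> 2"
  shows "distributed_state n (root_circuit (pauli_X * hadamard)) (intermediate_circuit n) (flip_pattern e) =
    ghz (e 0) (map e [1..<n])"
proof -
  obtain l where l: "n = Suc l" using n by (cases n) auto
  show ?thesis
    unfolding distributed_state_def received_state_flip_pattern intermediate_step_root_vec[OF n]
    using fold_flip_pattern_ghz[of l l e "e 0"] by (simp add: l)
qed


section \<open>GHZ-diagonal states\<close>

definition ghz_diagonal :: "nat \<Rightarrow> (bool \<Rightarrow> bool list \<Rightarrow> real) \<Rightarrow> complex Matrix.mat" where
  "ghz_diagonal n w = mat_sum (2 ^ n)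
     (\<lambda>s. w False s \<cdot>\<^sub>m ghz False s + w True s \<cdot>\<^sub>m ghz True s) {s. length s = n - 1}"

lemma ghz_carriers:
  assumes "n > 0" "length s = n - 1"
  shows "ghz b s \<in> carrier_mat (2 ^ n) (2 ^ n)" "ghz_vec b s \<in> carrier_vec (2 ^ n)"
  using ghz_carrier[of b s] ghz_vec_carrier[of b s] assms by simp_all

text \<open>An arbitrary \<open>v\<close> is allowed because positivity needs all vectors; GHZ
  vectors as \<open>v\<close> give the Born probabilities.\<close>

lemma quadratic_form_ghz_diagonal:
  assumes n: "n > 0" and v: "v \<in> carrier_vec (2 ^ n)"
  shows "(ghz_diagonal n w *\<^sub>v v) \<bullet>c v = complex_of_real (\<Sum>s | length s = n - 1.
      w False s * (cmod (ghz_vec False s \<bullet>c v))\<^sup>2 + w True s * (cmod (ghz_vec True s \<bullet>c v))\<^sup>2)"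
proof -
  note G = ghz_carriers[OF n]
  have Q: "(ghz b s *\<^sub>v v) \<bullet>c v = complex_of_real ((cmod (ghz_vec b s \<bullet>c v))\<^sup>2)" if "length s = n - 1" for b s
    unfolding ghz_def using G(2)[OF that] v by (rule quadratic_form_proj)
  have "(ghz_diagonal n w *\<^sub>v v) \<bullet>c v = (\<Sum>s | length s = n - 1.
      ((w False s \<cdot>\<^sub>m ghz False s + w True s \<cdot>\<^sub>m ghz True s) *\<^sub>v v) \<bullet>c v)"
    unfolding ghz_diagonal_def using v by (rule quadratic_form_mat_sum) (simp add: G)
  also have "\<dots> = (\<Sum>s | length s = n - 1. complex_of_real
      (w False s * (cmod (ghz_vec False s \<bullet>c v))\<^sup>2 + w True s * (cmod (ghz_vec True s \<bullet>c v))\<^sup>2))"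
    using G v by (intro sum.cong refl) (simp add: quadratic_form_mixture[where d = "2 ^ n"] Q)
  finally show ?thesis by simp
qed

lemma ghz_born_ghz_diagonal:
  assumes n: "n > 0" and s: "length s = n - 1"
  shows "ghz_born (ghz_diagonal n w) b s = w b s"
proof -
  have "ghz_born (ghz_diagonal n w) b s = (\<Sum>t | length t = n - 1. if t = s then w b s else 0)"
    unfolding ghz_born_def quadratic_form_ghz_diagonal[OF n ghz_carriers(2)[OF n s]] Re_complex_of_real
    using s by (intro sum.cong refl) (cases b, auto simp: cscalar_prod_ghz_vec)
  thus ?thesis using s finite_bool_lists by (simp add: sum.delta)
qed

lemma density_operator_ghz_diagonal:
  assumes n: "n > 0" and nonneg: "\<And>b s. length s = n - 1 \<Longrightarrow> w b s \<ge> 0"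
    and sum: "(\<Sum>s | length s = n - 1. w False s + w True s) = 1"
  shows "density_operator (2 ^ n) (ghz_diagonal n w)"
proof -
  note G = ghz_carriers[OF n]
  have D: "dim_row (ghz b s) = 2 ^ n" "dim_col (ghz b s) = 2 ^ n" "dim_vec (ghz_vec b s) = 2 ^ n"
    if "length s = n - 1" for b s
    using carrier_matD[OF G(1)[OF that]] carrier_vecD[OF G(2)[OF that]] by auto
  have adj: "mat_adjoint (ghz_diagonal n w) = ghz_diagonal n w"
    by (rule eq_matI) (auto simp: ghz_diagonal_def ghz_def D[unfolded ghz_def] mult_ac simp del: dim_ghz_vec intro!: sum.cong)
  have tr: "(\<Sum>i<2 ^ n. ghz b s $$ (i, i)) = 1" if "length s = n - 1" for b s
  proof -
    \<comment> \<open>The trace of a projection is the squared norm of its vector.\<close>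
    have "(\<Sum>i<2 ^ n. ghz b s $$ (i, i)) = ghz_vec b s \<bullet>c ghz_vec b s"
      using D[OF that] by (auto simp: ghz_def scalar_prod_def atLeast0LessThan intro!: sum.cong)
    thus ?thesis by (simp add: cscalar_prod_ghz_vec)
  qed
  have "(\<Sum>i<2 ^ n. ghz_diagonal n w $$ (i, i)) =
      (\<Sum>i<2 ^ n. \<Sum>s | length s = n - 1. w False s * ghz False s $$ (i, i) + w True s * ghz True s $$ (i, i))"
    by (auto simp: ghz_diagonal_def D intro!: sum.cong)
  also have "\<dots> = (\<Sum>s | length s = n - 1. \<Sum>i<2 ^ n. w False s * ghz False s $$ (i, i) + w True s * ghz True s $$ (i, i))"
    by (rule sum.swap)
  also have "\<dots> = (\<Sum>s | length s = n - 1. complex_of_real (w False s + w True s))"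
    by (intro sum.cong refl) (simp add: sum.distrib tr flip: sum_distrib_left)
  also have "\<dots> = 1"
    unfolding of_real_sum[symmetric] sum by simp
  finally have "(\<Sum>i<2 ^ n. ghz_diagonal n w $$ (i, i)) = 1" .
  moreover have "ghz_diagonal n w \<in> carrier_mat (2 ^ n) (2 ^ n)"
    unfolding ghz_diagonal_def by blast
  moreover have "Re ((ghz_diagonal n w *\<^sub>v v) \<bullet>c v) \<ge> 0" if "v \<in> carrier_vec (2 ^ n)" for v
    unfolding quadratic_form_ghz_diagonal[OF n that] Re_complex_of_real
    using nonneg by (intro sum_nonneg add_nonneg_nonneg mult_nonneg_nonneg) auto
  ultimately show ?thesis using adj unfolding density_operator_def by blast
qed

text \<open>A function that is the mass function of a known \<open>p\<close> is sent back to
  \<open>p\<close> by \<open>embed_pmf\<close>; nonnegativity and normalization of the Born weights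
  come with \<open>p\<close>.\<close>

lemma ghz_measure_eqI:
  assumes "\<And>b s. length s = n - 1 \<Longrightarrow> pmf p (b, s) = ghz_born \<rho> b s"
    and "\<And>b s. length s \<noteq> n - 1 \<Longrightarrow> pmf p (b, s) = 0"
  shows "ghz_measure n \<rho> = p"
proof -
  have "(\<lambda>(b, s). if length s = n - 1 then ghz_born \<rho> b s else 0) = pmf p"
    using assms by (intro ext) auto
  thus ?thesis
    unfolding ghz_measure_def using type_definition.Rep_inverse[OF td_pmf_embed_pmf] by metis
qed


section \<open>Outcome statistics\<close>

text \<open>The law of the independent flips, relabelled by GHZ outcomes: the common reference for
  the measured mixture and for the average over fixed flip patterns.\<close>

definition outcome_pmf :: "nat \<Rightarrow> (nat \<Rightarrow> real) \<Rightarrow> (bool \<times> bool list) pmf" where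
  "outcome_pmf n \<theta> = map_pmf (\<lambda>e. (e 0, map e [1..<n])) (flip_pmf n \<theta>)"

lemma pmf_outcome_pmf:
  assumes n: "n > 0" and \<theta>: "flip_parameters n \<theta>" and s: "length s = n - 1"
  shows "pmf (outcome_pmf n \<theta>) (b, s) = (if b then 1 - \<theta> 0 else \<theta> 0) * beta0 n \<theta> s"
proof -
  \<comment> \<open>The unique pattern on the channels below \<open>n\<close> that carries the label
    \<open>(b, s)\<close>.\<close>
  define t where "t j = (if j = 0 then b else s ! (j - 1))" for j
  have iff: "((e 0, map e [1..<n]) = (b, s)) \<longleftrightarrow> (\<forall>j<n. e j = t j)" for e
  proof
    assume *: "(e 0, map e [1..<n]) = (b, s)"
    have "e j = t j" if "j < n" for j
    proof (cases j)
      case (Suc i)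
      have "map e [1..<n] ! i = s ! i" using * by (simp only: prod.inject)
      thus ?thesis using Suc that by (simp add: t_def)
    qed (use * in \<open>simp add: t_def\<close>)
    thus "\<forall>j<n. e j = t j" by blast
  next
    assume *: "\<forall>j<n. e j = t j"
    have "map e [1..<n] = s"
    proof (rule nth_equalityI)
      fix i assume "i < length (map e [1..<n])"
      thus "map e [1..<n] ! i = s ! i" using *[rule_format, of "Suc i"] by (simp add: t_def)
    qed (use s in simp)
    thus "(e 0, map e [1..<n]) = (b, s)" using * n by (simp add: t_def)
  qed
  \<comment> \<open>The event is a product set, so independence turns its probability into a product
    over the channels.\<close>
  have "(\<lambda>e. (e 0, map e [1..<n])) -` {(b, s)} = Pi {..<n} (\<lambda>j. {t j})"
    by (simp only: vimage_def Pi_def singleton_iff iff lessThan_iff)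
  hence "pmf (outcome_pmf n \<theta>) (b, s) = (\<Prod>j<n. pmf (bernoulli_pmf (1 - \<theta> j)) (t j))"
    by (simp add: outcome_pmf_def pmf_map flip_pmf_def measure_Pi_pmf_Pi measure_pmf_single)
  also have "\<dots> = (\<Prod>j<n. if t j then 1 - \<theta> j else \<theta> j)"
    using \<theta> by (intro prod.cong refl) (auto simp: flip_parameters_def)
  also have "{..<n} = insert 0 {1..<n}" using n by auto
  also have "(\<Prod>j \<in> insert 0 {1..<n}. if t j then 1 - \<theta> j else \<theta> j) =
      (if b then 1 - \<theta> 0 else \<theta> 0) * (\<Prod>j = 1..<n. if t j then 1 - \<theta> j else \<theta> j)"
    by (subst prod.insert) (auto simp: t_def)
  also have "(\<Prod>j = 1..<n. if t j then 1 - \<theta> j else \<theta> j) = beta0 n \<theta> s"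
    unfolding beta0_alt by (intro prod.cong) (auto simp: t_def)
  finally show ?thesis .
qed

lemma ghz_measure_ghz_diagonal:
  assumes n: "n > 0" and \<theta>: "flip_parameters n \<theta>"
  shows "ghz_measure n (ghz_diagonal n (\<lambda>b s. (if b then 1 - \<theta> 0 else \<theta> 0) * beta0 n \<theta> s)) = outcome_pmf n \<theta>"
proof (rule ghz_measure_eqI)
  fix b and s :: "bool list" assume "length s \<noteq> n - 1"
  hence "(b, s) \<notin> set_pmf (outcome_pmf n \<theta>)"
    by (auto simp: outcome_pmf_def)
  thus "pmf (outcome_pmf n \<theta>) (b, s) = 0" by (simp add: set_pmf_iff)
qed (simp add: pmf_outcome_pmf[OF n \<theta>] ghz_born_ghz_diagonal[OF n])

lemma ghz_measure_ghz:
  assumes s: "length s = n - 1" and n: "n > 0"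
  shows "ghz_measure n (ghz b s) = return_pmf (b, s)"
  by (rule ghz_measure_eqI) (use s in \<open>auto simp: ghz_born_ghz indicator_def\<close>)

lemma map_indicator_bit_outcome_pmf:
  assumes "j < n"
  shows "map_pmf (indicator_bit j) (outcome_pmf n \<theta>) = bernoulli_pmf (1 - \<theta> j)"
proof -
  have "indicator_bit j (e 0, map e [1..<n]) = e j" for e
    using assms by (auto simp: indicator_bit_def)
  thus ?thesis
    using assms Pi_pmf_component[of "{..<n}" j False "\<lambda>j. bernoulli_pmf (1 - \<theta> j)"]
    by (simp add: outcome_pmf_def map_pmf_comp flip_pmf_def)
qed

section \<open>Counts and the estimator\<close>

lemma map_card_runs_pmf:
  assumes p: "map_pmf (indicator_bit j) p = bernoulli_pmf q" and q: "q \<in> {0..1}"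
  shows "map_pmf (\<lambda>r. card {k. k < N \<and> indicator_bit j (r k)}) (runs_pmf N p) = binomial_pmf N q"
proof -
  \<comment> \<open>The default value is the image of the default \<open>(False, [])\<close> of
    \<open>runs_pmf\<close>, as mapping a product distribution requires; only runs below
    \<open>N\<close> are counted.\<close>
  have "binomial_pmf N q = map_pmf (\<lambda>f. card {k \<in> {..<N}. f k})
      (Pi_pmf {..<N} (indicator_bit j (False, [])) (\<lambda>_. bernoulli_pmf q))"
    using q by (intro binomial_pmf_altdef') auto
  also have "\<dots> = map_pmf (\<lambda>r. card {k. k < N \<and> indicator_bit j (r k)}) (runs_pmf N p)"
    unfolding p[symmetric] runs_pmf_def
    by (subst Pi_pmf_map[where dflt = "(False, [])"]) (simp_all add: map_pmf_comp)
  finally show ?thesis ..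
qed

lemma expectation_estimate:
  assumes p: "map_pmf (indicator_bit j) p = bernoulli_pmf q" and q: "q \<in> {0..1}" and N: "N \<ge> 1"
  shows "measure_pmf.expectation (runs_pmf N p) (estimate N j) = 1 - q"
proof -
  \<comment> \<open>The indicator of run \<open>k\<close>. The estimate is 1 minus the average of
    these, so linearity of expectation reduces the claim to a single run.\<close>
  define f :: "nat \<Rightarrow> (nat \<Rightarrow> bool \<times> bool list) \<Rightarrow> real"
    where "f k r = of_bool (indicator_bit j (r k))" for k r
  have int: "integrable (measure_pmf (runs_pmf N p)) (f k)" for k
    by (rule measure_pmf.integrable_const_bound[where B = 1]) (auto simp: f_def)
  have E: "measure_pmf.expectation (runs_pmf N p) (f k) = q" if "k < N" for k
  proof -
    have "map_pmf (\<lambda>r. indicator_bit j (r k)) (runs_pmf N p) = bernoulli_pmf q"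
      using Pi_pmf_component[of "{..<N}" k "(False, [])" "\<lambda>_. p"] that p
      by (simp add: runs_pmf_def flip: map_pmf_comp[of "indicator_bit j" "\<lambda>r. r k"])
    hence "measure_pmf.expectation (runs_pmf N p) (f k) = measure_pmf.expectation (bernoulli_pmf q) of_bool"
      using integral_map_pmf[of "\<lambda>r. indicator_bit j (r k)" "runs_pmf N p" "of_bool :: bool \<Rightarrow> real"]
      by (simp add: f_def[abs_def])
    thus ?thesis using q by simp
  qed
  have "estimate N j r = 1 - (\<Sum>k<N. f k r) / N" for r
  proof -
    have "{..<N} \<inter> {k. indicator_bit j (r k)} = {k. k < N \<and> indicator_bit j (r k)}" by auto
    thus ?thesis by (simp add: estimate_def f_def)
  qed
  hence "measure_pmf.expectation (runs_pmf N p) (estimate N j) =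
      measure_pmf.expectation (runs_pmf N p) (\<lambda>r. 1 - (\<Sum>k<N. f k r) / N)" by presburger
  also have "\<dots> = 1 - (\<Sum>k<N. measure_pmf.expectation (runs_pmf N p) (f k)) / N"
    by (simp add: int)
  finally show ?thesis using N by (simp add: E)
qed

lemma estimate_consistent:
  assumes p: "map_pmf (indicator_bit j) p = bernoulli_pmf q" and q: "q \<in> {0..1}" and \<epsilon>: "\<epsilon> > 0"
  shows "(\<lambda>N. measure_pmf.prob (runs_pmf N p) {r. \<bar>estimate N j r - (1 - q)\<bar> \<ge> \<epsilon>}) \<longlonglongrightarrow> 0"
proof (rule tendsto_sandwich[where f = "\<lambda>_. 0" and h = "\<lambda>N. 2 * exp (-2 * \<epsilon>\<^sup>2) ^ N"])
  have "(\<lambda>N. 2 * exp (-2 * \<epsilon>\<^sup>2) ^ N) \<longlonglongrightarrow> 2 * 0"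
    \<comment> \<open>The bound is geometric in \<open>N\<close> with ratio
      \<open>exp (-2 * \<epsilon>\<^sup>2)\<close>, which is below 1.\<close>
    using \<epsilon> by (intro tendsto_mult tendsto_const LIMSEQ_realpow_zero) auto
  thus "(\<lambda>N. 2 * exp (-2 * \<epsilon>\<^sup>2) ^ N) \<longlonglongrightarrow> 0" by simp
  show "\<forall>\<^sub>F N in sequentially. measure_pmf.prob (runs_pmf N p) {r. \<bar>estimate N j r - (1 - q)\<bar> \<ge> \<epsilon>}
      \<le> 2 * exp (-2 * \<epsilon>\<^sup>2) ^ N"
  proof (rule eventually_mono[OF eventually_gt_at_top[of 0]])
    fix N :: nat assume N: "N > 0"
    let ?c = "\<lambda>r. card {k. k < N \<and> indicator_bit j (r k)}"
    have "measure_pmf.prob (runs_pmf N p) {r. \<bar>estimate N j r - (1 - q)\<bar> \<ge> \<epsilon>} =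
        measure_pmf.prob (map_pmf ?c (runs_pmf N p)) {x. \<bar>real x / real N - q\<bar> \<ge> \<epsilon>}"
      by (simp add: estimate_def vimage_def abs_minus_commute)
    \<comment> \<open>Hoeffding's bound for the binomial count, with the deviation measured relative
      to \<open>N > 0\<close>.\<close>
    also have "\<dots> \<le> 2 * exp (-2 * real N * \<epsilon>\<^sup>2)"
      using binomial_distribution.prob_abs_ge'[of q N \<epsilon>] q N \<epsilon>
      by (simp add: map_card_runs_pmf[OF p q] binomial_distribution_def)
    also have "exp (-2 * real N * \<epsilon>\<^sup>2) = exp (-2 * \<epsilon>\<^sup>2) ^ N"
      by (simp add: mult_ac flip: exp_of_nat_mult)
    finally show "measure_pmf.prob (runs_pmf N p) {r. \<bar>estimate N j r - (1 - q)\<bar> \<ge> \<epsilon>}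
      \<le> 2 * exp (-2 * \<epsilon>\<^sup>2) ^ N" .
  qed
qed simp_all

text \<open>The equation between \<open>pmf\<close> and \<open>ghz_born\<close> certifies that
  \<open>embed_pmf\<close> in \<open>ghz_measure\<close> is applied to a genuine mass function. The
  last conjunct is identifiability: among all admissible parameters, the outcome law determines each
  one.\<close>

theorem mainTheorem3:
  fixes n :: nat and \<theta> :: "nat \<Rightarrow> real"
    and C0 Cn :: "complex Matrix.mat list"
    and \<rho> :: "(nat \<Rightarrow> real) \<Rightarrow> complex Matrix.mat"
  assumes n: "n \<ge> 2"
    and \<theta>: "flip_parameters n \<theta>"
    and C0: "C0 = root_circuit (pauli_X * hadamard)"
    and Cn: "Cn = intermediate_circuit n"
    and \<rho>: "\<rho> = (\<lambda>\<theta>'. distributed_state n C0 Cn (bit_flip_channels \<theta>'))"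
  shows
    "(received_state [hadamard \<otimes>\<^sub>m 1\<^sub>m 2, cnot] (bit_flip_channels \<theta>)
       = \<theta> 0 \<cdot>\<^sub>m ghz False [False] + (1 - \<theta> 0) \<cdot>\<^sub>m ghz False [True]) \<and>
     (run_circuit [(pauli_X * hadamard) \<otimes>\<^sub>m 1\<^sub>m 2, 1\<^sub>m 2 \<otimes>\<^sub>m (hadamard * pauli_Z)]
         (\<theta> 0 \<cdot>\<^sub>m ghz False [False] + (1 - \<theta> 0) \<cdot>\<^sub>m ghz False [True])
       = \<theta> 0 \<cdot>\<^sub>m ghz False [False] + (1 - \<theta> 0) \<cdot>\<^sub>m ghz True [False]) \<and>
     (intermediate_step n Cn (received_state C0 (bit_flip_channels \<theta>))
       = \<theta> 0 \<cdot>\<^sub>m ghz False (replicate (n - 1) False)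
         + (1 - \<theta> 0) \<cdot>\<^sub>m ghz True (replicate (n - 1) False)) \<and>
     (density_operator (2 ^ n) (\<rho> \<theta>)) \<and>
     (\<rho> \<theta> = mat_sum (2 ^ n) (\<lambda>s. (\<theta> 0 * beta0 n \<theta> s) \<cdot>\<^sub>m ghz False s
         + ((1 - \<theta> 0) * beta0 n \<theta> s) \<cdot>\<^sub>m ghz True s) {s. length s = n - 1}) \<and>
     (\<rho> \<theta> = mat_sum (2 ^ n) (\<lambda>s. (\<theta> 0 * beta0 n \<theta> s) \<cdot>\<^sub>m ghz False s
         + ((1 - \<theta> 0) * beta1 n \<theta> s) \<cdot>\<^sub>m ghz True (map Not s)) {s. length s = n - 1}) \<and>
     (distributed_state n (root_circuit (pauli_X * hadamard * pauli_X)) Cn (bit_flip_channels \<theta>)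
       = mat_sum (2 ^ n) (\<lambda>s. (\<theta> 0 * beta0 n \<theta> s) \<cdot>\<^sub>m ghz True s
         + ((1 - \<theta> 0) * beta0 n \<theta> s) \<cdot>\<^sub>m ghz False s) {s. length s = n - 1}) \<and>
     (\<forall>b s. length s = n - 1 \<longrightarrow> pmf (ghz_measure n (\<rho> \<theta>)) (b, s) = ghz_born (\<rho> \<theta>) b s) \<and>
     (map_pmf snd (flips_and_outcome n C0 Cn \<theta>) = ghz_measure n (\<rho> \<theta>)) \<and>
     (\<forall>(e, b, s) \<in> set_pmf (flips_and_outcome n C0 Cn \<theta>).
       length s = n - 1 \<and> (e 0 \<longleftrightarrow> b) \<and> (\<forall>j\<in>{1..<n}. e j \<longleftrightarrow> s ! (j - 1))) \<and>
     (\<forall>j<n. measure_pmf.prob (ghz_measure n (\<rho> \<theta>)) {r. indicator_bit j r} = 1 - \<theta> j) \<and>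
     (\<forall>j<n. \<forall>N\<ge>1.
       measure_pmf.expectation (runs_pmf N (ghz_measure n (\<rho> \<theta>))) (estimate N j) = \<theta> j) \<and>
     (\<forall>j<n. \<forall>\<epsilon>>0. (\<lambda>N. measure_pmf.prob (runs_pmf N (ghz_measure n (\<rho> \<theta>)))
       {r. \<bar>estimate N j r - \<theta> j\<bar> \<ge> \<epsilon>}) \<longlonglongrightarrow> 0) \<and>
     (\<forall>\<theta>'. flip_parameters n \<theta>' \<and> ghz_measure n (\<rho> \<theta>') = ghz_measure n (\<rho> \<theta>)
       \<longrightarrow> (\<forall>j<n. \<theta>' j = \<theta> j))"
proof -
  define w :: "(nat \<Rightarrow> real) \<Rightarrow> bool \<Rightarrow> bool list \<Rightarrow> real"
    where "w \<theta> b s = (if b then 1 - \<theta> 0 else \<theta> 0) * beta0 n \<theta> s" for \<theta> b s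
  have n0: "n > 0" using n by simp
  have range: "1 - \<theta>' j \<in> {0..1}" if "flip_parameters n \<theta>'" "j < n" for \<theta>' j
    using that by (auto simp: flip_parameters_def)
  have state: "\<rho> \<theta>' = mat_sum (2 ^ n) (\<lambda>s. (\<theta>' 0 * beta0 n \<theta>' s) \<cdot>\<^sub>m ghz False s
      + ((1 - \<theta>' 0) * beta0 n \<theta>' s) \<cdot>\<^sub>m ghz True s) {s. length s = n - 1}" for \<theta>'
    unfolding \<rho> C0 Cn
    using distributed_state_bit_flip_channels[OF n, of _ \<theta>' "\<theta>' 0" False "1 - \<theta>' 0" True]
      received_state_root[of \<theta>'] by simp
  hence diag: "\<rho> \<theta>' = ghz_diagonal n (w \<theta>')" for \<theta>'
    by (simp add: ghz_diagonal_def w_def)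
  have meas: "ghz_measure n (\<rho> \<theta>') = outcome_pmf n \<theta>'" if "flip_parameters n \<theta>'" for \<theta>'
    unfolding diag w_def by (rule ghz_measure_ghz_diagonal[OF n0 that])
  have marginal: "map_pmf (indicator_bit j) (ghz_measure n (\<rho> \<theta>')) = bernoulli_pmf (1 - \<theta>' j)"
    if "flip_parameters n \<theta>'" "j < n" for \<theta>' j
    unfolding meas[OF that(1)] by (rule map_indicator_bit_outcome_pmf[OF that(2)])
  have prob: "measure_pmf.prob (ghz_measure n (\<rho> \<theta>')) {r. indicator_bit j r} = 1 - \<theta>' j"
    if "flip_parameters n \<theta>'" "j < n" for \<theta>' j
  proof -
    have "measure_pmf.prob (ghz_measure n (\<rho> \<theta>')) {r. indicator_bit j r} =
        measure_pmf.prob (map_pmf (indicator_bit j) (ghz_measure n (\<rho> \<theta>'))) {True}"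
      by (simp add: vimage_def)
    thus ?thesis
      using range[OF that] by (simp add: marginal[OF that] measure_pmf_single)
  qed
  have weights: "w \<theta> b s \<ge> 0" for b s
  proof -
    have "beta0 n \<theta> s \<ge> 0"
      unfolding beta0_alt using \<theta> by (intro prod_nonneg) (auto simp: flip_parameters_def)
    thus ?thesis using \<theta> n0 by (auto simp: w_def flip_parameters_def)
  qed
  have weights_sum: "(\<Sum>s | length s = n - 1. w \<theta> False s + w \<theta> True s) = 1"
    using sum_beta0[of "n - 1" \<theta>] n0 by (simp add: w_def algebra_simps)
  \<comment> \<open>A fixed pattern ends in a pure GHZ state, whose measurement is certain. The
    outcome is thus a function of \<open>e\<close>, and support and marginal can be read
    off.\<close>
  have joint: "flips_and_outcome n C0 Cn \<theta> = map_pmf (\<lambda>e. (e, e 0, map e [1..<n])) (flip_pmf n \<theta>)"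
    unfolding flips_and_outcome_def C0 Cn distributed_state_flip_pattern[OF n]
    by (simp add: ghz_measure_ghz[OF _ n0] map_pmf_def bind_return_pmf)

  have state': "\<rho> \<theta> = mat_sum (2 ^ n) (\<lambda>s. (\<theta> 0 * beta0 n \<theta> s) \<cdot>\<^sub>m ghz False s
      + ((1 - \<theta> 0) * beta1 n \<theta> s) \<cdot>\<^sub>m ghz True (map Not s)) {s. length s = n - 1}"
  proof (rule eq_matI)
    let ?M = "mat_sum (2 ^ n) (\<lambda>s. (\<theta> 0 * beta0 n \<theta> s) \<cdot>\<^sub>m ghz False s
      + ((1 - \<theta> 0) * beta1 n \<theta> s) \<cdot>\<^sub>m ghz True (map Not s)) {s. length s = n - 1}"
    fix i j assume "i < dim_row ?M" "j < dim_col ?M"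
    hence ij: "i < 2 ^ n" "j < 2 ^ n" by simp_all
    have D: "dim_row (ghz b s) = 2 ^ n" "dim_col (ghz b s) = 2 ^ n" if "length s = n - 1" for b s
      using carrier_matD[OF ghz_carriers(1)[OF n0 that]] by auto
    have "(\<Sum>s | length s = n - 1. (1 - \<theta> 0) * beta1 n \<theta> s * ghz True (map Not s) $$ (i, j)) =
        (\<Sum>s | length s = n - 1. (1 - \<theta> 0) * beta0 n \<theta> s * ghz True s $$ (i, j))"
      \<comment> \<open>Complementing the strings is an involution that turns \<open>beta1\<close>
        into \<open>beta0\<close>.\<close>
      by (rule sum.reindex_bij_witness[where i = "map Not" and j = "map Not"])
        (auto simp: beta1_eq_beta0 comp_def)
    thus "\<rho> \<theta> $$ (i, j) = ?M $$ (i, j)"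
      unfolding state index_mat_sum[OF ij] using ij
      by (simp add: D sum.distrib)
  qed (simp_all add: state)

  show ?thesis
  proof (intro conjI)
    show "received_state [hadamard \<otimes>\<^sub>m 1\<^sub>m 2, cnot] (bit_flip_channels \<theta>)
       = \<theta> 0 \<cdot>\<^sub>m ghz False [False] + (1 - \<theta> 0) \<cdot>\<^sub>m ghz False [True]"
      using received_state_bell by simp
    show "run_circuit [(pauli_X * hadamard) \<otimes>\<^sub>m 1\<^sub>m 2, 1\<^sub>m 2 \<otimes>\<^sub>m (hadamard * pauli_Z)]
         (\<theta> 0 \<cdot>\<^sub>m ghz False [False] + (1 - \<theta> 0) \<cdot>\<^sub>m ghz False [True])
       = \<theta> 0 \<cdot>\<^sub>m ghz False [False] + (1 - \<theta> 0) \<cdot>\<^sub>m ghz True [False]"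
      by (rule run_two_qubit_circuit)
    have "proj (root_vec b) \<in> carrier_mat 4 4" for b by blast
    thus "intermediate_step n Cn (received_state C0 (bit_flip_channels \<theta>))
       = \<theta> 0 \<cdot>\<^sub>m ghz False (replicate (n - 1) False)
         + (1 - \<theta> 0) \<cdot>\<^sub>m ghz True (replicate (n - 1) False)"
      unfolding C0 Cn received_state_root
      by (simp add: intermediate_step_mixture[OF n] intermediate_step_root_vec[OF n])
    show "density_operator (2 ^ n) (\<rho> \<theta>)"
      unfolding diag using weights weights_sum by (intro density_operator_ghz_diagonal n0)
    show "distributed_state n (root_circuit (pauli_X * hadamard * pauli_X)) Cn (bit_flip_channels \<theta>)
       = mat_sum (2 ^ n) (\<lambda>s. (\<theta> 0 * beta0 n \<theta> s) \<cdot>\<^sub>m ghz True s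
         + ((1 - \<theta> 0) * beta0 n \<theta> s) \<cdot>\<^sub>m ghz False s) {s. length s = n - 1}"
      unfolding Cn using distributed_state_bit_flip_channels[OF n, of _ \<theta> "\<theta> 0" True "1 - \<theta> 0" False]
        received_state_root_XHX[of \<theta>] by simp
    show "\<forall>b s. length s = n - 1 \<longrightarrow> pmf (ghz_measure n (\<rho> \<theta>)) (b, s) = ghz_born (\<rho> \<theta>) b s"
      unfolding meas[OF \<theta>] using ghz_born_ghz_diagonal[OF n0] pmf_outcome_pmf[OF n0 \<theta>]
      by (simp add: diag w_def)
    show "map_pmf snd (flips_and_outcome n C0 Cn \<theta>) = ghz_measure n (\<rho> \<theta>)"
      unfolding joint meas[OF \<theta>] outcome_pmf_def by (simp add: map_pmf_comp)
    show "\<forall>(e, b, s) \<in> set_pmf (flips_and_outcome n C0 Cn \<theta>).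
       length s = n - 1 \<and> (e 0 \<longleftrightarrow> b) \<and> (\<forall>j\<in>{1..<n}. e j \<longleftrightarrow> s ! (j - 1))"
      unfolding joint by auto
    show "\<forall>j<n. measure_pmf.prob (ghz_measure n (\<rho> \<theta>)) {r. indicator_bit j r} = 1 - \<theta> j"
      using prob[OF \<theta>] by blast
    show "\<forall>j<n. \<forall>N\<ge>1. measure_pmf.expectation (runs_pmf N (ghz_measure n (\<rho> \<theta>))) (estimate N j) = \<theta> j"
      using expectation_estimate[OF marginal[OF \<theta>] range[OF \<theta>]] by simp
    show "\<forall>j<n. \<forall>\<epsilon>>0. (\<lambda>N. measure_pmf.prob (runs_pmf N (ghz_measure n (\<rho> \<theta>)))
       {r. \<bar>estimate N j r - \<theta> j\<bar> \<ge> \<epsilon>}) \<longlonglongrightarrow> 0"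
      using estimate_consistent[OF marginal[OF \<theta>] range[OF \<theta>]] by simp
    show "\<forall>\<theta>'. flip_parameters n \<theta>' \<and> ghz_measure n (\<rho> \<theta>') = ghz_measure n (\<rho> \<theta>)
       \<longrightarrow> (\<forall>j<n. \<theta>' j = \<theta> j)"
    \<comment> \<open>Each parameter is 1 minus a probability under the outcome law, so equal laws
      force equal parameters.\<close>
    proof (intro allI impI, elim conjE)
      fix \<theta>' j assume "flip_parameters n \<theta>'" "ghz_measure n (\<rho> \<theta>') = ghz_measure n (\<rho> \<theta>)" "j < n"
      thus "\<theta>' j = \<theta> j" using prob[of \<theta>' j] prob[OF \<theta>, of j] by simp
    qed
  qed (fact state state')+
qed

end
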